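(* Let $f_0$ be a strictly positive probability density on $\mathbb{R}^d$, $f_\theta(x)=f_0(x-\theta)$, let $f^\star=\sum_{i=1}^{q^\star}\pi_i^\star f_{\theta_i^\star}$ be a nondegenerate mixture, and let $A_0,A_1,\ldots,A_{q^\star}$ be the fixed partition of $\mathbb{R}^d$ described in the context. Suppose that (1) $f_0\in C^2$ and $f_0(x)$, $D_1f_0(x)$ vanish as $\|x\|\to\infty$; (2) $\|[D_1f_0]_i/f^\star\|_1<\infty$ and $\|[D_2f_0]_{ij}/f^\star\|_1<\infty$ for all $i,j=1,\ldots,d$. Then there exists a constant $c^\star>0$ (which may depend on $f^\star$ and $A_1,\ldots,A_{q^\star}$ but not on $\eta,\beta,\rho,\tau,\nu$) such that $$\|\ell(\eta,\beta,\rho,\tau,\nu)\|_1\ge c^\star\,N(\eta,\beta,\rho,\tau,\nu)\qquad\text{for all }(\eta,\beta,\rho,\tau,\nu)\in\mathfrak{D}.$$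
   Context: $\mu$ is Lebesgue measure on $\mathbb{R}^d$; $\|g\|_1=\int|g|f^\star d\mu$. $f_0>0$ with $\int f_0d\mu=1$. Nondegenerate means $\pi_i^\star>0$ for all $i$, $\sum_i\pi_i^\star=1$, and $\theta_i^\star\ne\theta_j^\star$ for $i\neq j$. For a vector $v$, $v^*$ denotes its transpose. The sets $A_1,\ldots,A_{q^\star}\subset\mathbb{R}^d$ are fixed bounded convex neighborhoods of $\theta_1^\star,\ldots,\theta_{q^\star}^\star$ respectively, such that for some linearly independent family $u_1,\ldots,u_d\in\mathbb{R}^d$ the sets $\langle A_i,u_j\rangle=\{\langle\theta,u_j\rangle:\theta\in A_i\}$, $i=1,\ldots,q^\star$, are disjoint for every $j=1,\ldots,d$. Set $A_0=\mathbb{R}^d\setminus(A_1\cup\cdots\cup A_{q^\star})$. For a finite measure $\lambda$ on $\mathbb{R}^d$, $f_\lambda(x)=\int f_\theta(x)\,\lambda(d\theta)$. $D_1f_\theta(x)\in\mathbb{R}^d$ and $D_2f_\theta(x)\in\mathbb{R}^{d\times d}$ are given by $[D_1f_\theta(x)]_i=\partial f_\theta(x)/\partial\theta^i$ and $[D_2f_\theta(x)]_{ij}=\partial^2f_\theta(x)/\partial\theta^i\partial\theta^j$ (and $D_1f_0,D_2f_0$ are these at $\theta=0$). $\mathfrak{P}(A)$ is the set of probability measures supported on $A\subseteq\mathbb{R}^d$; $M_+^d$ is the set of $d\times d$ symmetric positive semidefinite matrices. $\mathfrak{D}$ is the set of all $(\eta,\beta,\rho,\tau,\nu)$ with $\eta_1,\ldots,\eta_{q^\star}\in\mathbb{R}$,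 $\beta_1,\ldots,\beta_{q^\star}\in\mathbb{R}^d$, $\rho_1,\ldots,\rho_{q^\star}\in M_+^d$, $\tau_0,\ldots,\tau_{q^\star}\ge0$, $\nu_0\in\mathfrak{P}(A_0),\ldots,\nu_{q^\star}\in\mathfrak{P}(A_{q^\star})$. For such a tuple, $$\ell(\eta,\beta,\rho,\tau,\nu)=\tau_0\frac{f_{\nu_0}}{f^\star}+\sum_{i=1}^{q^\star}\bigg\{\eta_i\frac{f_{\theta_i^\star}}{f^\star}+\beta_i^*\frac{D_1f_{\theta_i^\star}}{f^\star}+\mathrm{Tr}\bigg[\rho_i\frac{D_2f_{\theta_i^\star}}{f^\star}\bigg]+\tau_i\frac{f_{\nu_i}}{f^\star}\bigg\},$$ $$N(\eta,\beta,\rho,\tau,\nu)=\tau_0+\sum_{i=1}^{q^\star}|\eta_i+\tau_i|+\sum_{i=1}^{q^\star}\bigg\|\beta_i+\tau_i\int(\theta-\theta_i^\star)\,\nu_i(d\theta)\bigg\|+\sum_{i=1}^{q^\star}\mathrm{Tr}[\rho_i]+\sum_{i=1}^{q^\star}\frac{\tau_i}{2}\int\|\theta-\theta_i^\star\|^2\,\nu_i(d\theta).$$ *)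

theory Defs
  imports "HOL-Probability.Probability"
begin

definition translate :: "(real^'d \<Rightarrow> real) \<Rightarrow> real^'d \<Rightarrow> real^'d \<Rightarrow> real" where
  "translate f0 \<theta> x = f0 (x - \<theta>)"

definition partial_deriv :: "'d::finite \<Rightarrow> (real^'d \<Rightarrow> real) \<Rightarrow> real^'d \<Rightarrow> real" where
  "partial_deriv i F y = deriv (\<lambda>t. F (y + t *\<^sub>R axis i 1)) 0"

text \<open>The class of k times continuously differentiable functions on the whole space.\<close>

primrec Ck :: "nat \<Rightarrow> (real^'d::finite \<Rightarrow> real) \<Rightarrow> bool" where
  "Ck 0 F \<longleftrightarrow> continuous_on UNIV F"
| "Ck (Suc k) F \<longleftrightarrow> F differentiable_on UNIV \<and> (\<forall>i. Ck k (partial_deriv i F))"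

text \<open>
  \<open>D1\<close> and \<open>D2\<close> differentiate with respect to the translation parameter \<open>\<theta>\<close>, not with respect
  to \<open>x\<close>: thus \<open>D1 f0 0 x\<close> is minus the gradient of \<open>f0\<close> at \<open>x\<close>.
\<close>

definition D1 :: "(real^'d::finite \<Rightarrow> real) \<Rightarrow> real^'d \<Rightarrow> real^'d \<Rightarrow> real^'d" where
  "D1 f0 \<theta> x = (\<chi> i. partial_deriv i (\<lambda>\<theta>'. translate f0 \<theta>' x) \<theta>)"

definition D2 :: "(real^'d::finite \<Rightarrow> real) \<Rightarrow> real^'d \<Rightarrow> real^'d \<Rightarrow> real^'d^'d" where
  "D2 f0 \<theta> x = (\<chi> i j. partial_deriv i (partial_deriv j (\<lambda>\<theta>'. translate f0 \<theta>' x)) \<theta>)"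

definition finite_mixture ::
  "(real^'d \<Rightarrow> real) \<Rightarrow> nat \<Rightarrow> (nat \<Rightarrow> real) \<Rightarrow> (nat \<Rightarrow> real^'d) \<Rightarrow> real^'d \<Rightarrow> real" where
  "finite_mixture f0 q p \<theta> x = (\<Sum>i=1..q. p i * translate f0 (\<theta> i) x)"

definition mixture :: "(real^'d \<Rightarrow> real) \<Rightarrow> (real^'d) measure \<Rightarrow> real^'d \<Rightarrow> real" where
  "mixture f0 m x = (\<integral>\<theta>. translate f0 \<theta> x \<partial>m)"

text \<open>The norm of \<open>L\<^sup>1(f d\<mu>)\<close>, with value \<open>\<infinity>\<close> for functions that are not integrable.\<close>

definition L1_norm :: "(real^'d \<Rightarrow> real) \<Rightarrow> (real^'d \<Rightarrow> real) \<Rightarrow> ennreal" where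
  "L1_norm f g = (\<integral>\<^sup>+ x. ennreal (\<bar>g x\<bar> * f x) \<partial>lborel)"

text \<open>
  Borel probability measures giving full mass to \<open>A\<close>. The almost-everywhere formulation also makes
  sense when \<open>A\<close> is not a Borel set (a convex set need not be one).
\<close>

definition prob_on :: "(real^'d) set \<Rightarrow> (real^'d) measure set" where
  "prob_on A = {\<nu>. prob_space \<nu> \<and> sets \<nu> = sets borel \<and> (AE \<theta> in \<nu>. \<theta> \<in> A)}"

definition psd_matrices :: "(real^'d^'d) set" where
  "psd_matrices = {R. transpose R = R \<and> (\<forall>v. 0 \<le> v \<bullet> (R *v v))}"

type_synonym 'd params =
  "(nat \<Rightarrow> real) \<times> (nat \<Rightarrow> real^'d) \<times> (nat \<Rightarrow> real^'d^'d) \<times> (nat \<Rightarrow> real) \<times> (nat \<Rightarrow> (real^'d) measure)"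

text \<open>
  In a tuple \<open>(\<eta>, \<beta>, \<rho>, \<tau>, \<nu>)\<close> only the indices \<open>1..q\<close> (for \<open>\<eta>, \<beta>, \<rho>\<close>) and \<open>0..q\<close> (for
  \<open>\<tau>, \<nu>\<close>) matter; neither \<open>ell\<close> nor \<open>N_size\<close> below looks at other indices.
\<close>

definition param_set :: "nat \<Rightarrow> (nat \<Rightarrow> (real^'d) set) \<Rightarrow> 'd::finite params set" where
  "param_set q A = {(\<eta>, \<beta>, \<rho>, \<tau>, \<nu>).
     (\<forall>i\<in>{1..q}. \<rho> i \<in> psd_matrices) \<and>
     (\<forall>i\<in>{0..q}. 0 \<le> \<tau> i) \<and>
     (\<forall>i\<in>{0..q}. \<nu> i \<in> prob_on (A i))}"

fun ell :: "(real^'d::finite \<Rightarrow> real) \<Rightarrow> (real^'d \<Rightarrow> real) \<Rightarrow> nat \<Rightarrow> (nat \<Rightarrow> real^'d) \<Rightarrow> 'd params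
    \<Rightarrow> real^'d \<Rightarrow> real" where
  "ell f0 fs q \<theta> (\<eta>, \<beta>, \<rho>, \<tau>, \<nu>) x =
     \<tau> 0 * (mixture f0 (\<nu> 0) x / fs x) +
     (\<Sum>i=1..q. \<eta> i * (translate f0 (\<theta> i) x / fs x)
        + \<beta> i \<bullet> (D1 f0 (\<theta> i) x /\<^sub>R fs x)
        + trace (\<rho> i ** (D2 f0 (\<theta> i) x /\<^sub>R fs x))
        + \<tau> i * (mixture f0 (\<nu> i) x / fs x))"

fun N_size :: "nat \<Rightarrow> (nat \<Rightarrow> real^'d::finite) \<Rightarrow> 'd params \<Rightarrow> real" where
  "N_size q \<theta> (\<eta>, \<beta>, \<rho>, \<tau>, \<nu>) =
     \<tau> 0 + (\<Sum>i=1..q. \<bar>\<eta> i + \<tau> i\<bar>)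
     + (\<Sum>i=1..q. norm (\<beta> i + \<tau> i *\<^sub>R (\<integral>t. (t - \<theta> i) \<partial>\<nu> i)))
     + (\<Sum>i=1..q. trace (\<rho> i))
     + (\<Sum>i=1..q. \<tau> i / 2 * (\<integral>t. (norm (t - \<theta> i))\<^sup>2 \<partial>\<nu> i))"

end

theory Submission
  imports Defs
begin

text \<open>
  The proof is by duality. Multiplied by \<open>f\<^sup>\<star>\<close>, the function \<open>\<ell>\<close> is \<open>L = f0 * T\<close> for a distribution
  \<open>T\<close> of order two built from the parameters. The Fourier transform of \<open>f0\<close> has modulus at least
  \<open>1/2\<close> on a ball around \<open>0\<close>; hence \<open>\<bar>T p\<bar> \<le> 2 W \<parallel>L\<parallel>\<^sub>1\<close> for every trigonometric polynomial
  \<open>p\<close> with frequencies in that ball and with sum \<open>W\<close> of absolute values of coefficients.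
  Testing \<open>T\<close> on \<open>\<Prod>\<^sub>k (1 - cos (s\<^sub>k \<bullet> (t - \<theta>\<^sub>k)))\<close>, which is nonnegative and vanishes to second order at
  each \<open>\<theta>\<^sub>k\<close>, controls \<open>Tr \<rho>\<^sub>i\<close>, \<open>\<tau>\<^sub>0\<close> and the second moments, the latter two after averaging over
  the \<open>s\<^sub>k\<close>. Omitting the factor \<open>k = i\<close>, or replacing it by a sine, isolates the remaining
  first-order terms at \<open>\<theta>\<^sub>i\<close>.
\<close>

subsection \<open>Fourier transforms\<close>

text \<open>On the exponential of frequency s, \<open>T\<close> takes the value
  \<open>ft L s / ft f0 s\<close>; this is where the factor 2 comes from. Away from 0 the transform
  of \<open>f0\<close> may vanish, so high frequencies, and with them compactly supported test
  functions, are out of reach. All test functions are analytic and almost periodic, and prescribed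
  zeros at the points \<open>\<theta> k\<close> take the place of localization. Every factor that
  produces a zero uses up part of the frequency budget.

  The order of the estimates is forced. When \<open>\<nu> i\<close> concentrates near
  \<open>\<theta> i\<close>, its contribution can nearly cancel against \<open>\<eta> i\<close> and
  \<open>\<beta> i\<close>, so \<open>\<tau> i\<close> cannot be bounded by itself. The second-order
  quantities have a sign, so nonnegative test functions with double zeros bound them without
  cancellation. Only then can \<open>\<nu> i\<close> be expanded to first order at
  \<open>\<theta> i\<close>: the coefficients are \<open>\<eta> i + \<tau> i\<close> and
  \<open>\<beta> i\<close> plus \<open>\<tau> i\<close> times the first moment, exactly the
  combinations in \<open>N_size\<close>, and the error is a multiple of what has already been
  bounded. No compactness argument on the parameters occurs.\<close>

definition ft :: "('a::euclidean_space \<Rightarrow> real) \<Rightarrow> 'a \<Rightarrow> complex" where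
  "ft f s = (\<integral>x. cis (s \<bullet> x) * complex_of_real (f x) \<partial>lborel)"

lemma borel_measurable_cis [measurable]: "cis \<in> borel_measurable borel"
  by (intro borel_measurable_continuous_onI continuous_intros)

lemma integrable_cis_mult:
  fixes f :: "'a::euclidean_space \<Rightarrow> real"
  assumes "integrable lborel f"
  shows "integrable lborel (\<lambda>x. cis (s \<bullet> x) * complex_of_real (f x))"
  by (rule Bochner_Integration.integrable_bound[OF assms])
     (use assms in \<open>auto simp: norm_mult dest!: borel_measurable_integrable\<close>)

lemma norm_ft_le:
  fixes f :: "'a::euclidean_space \<Rightarrow> real"
  shows "norm (ft f s) \<le> (\<integral>x. \<bar>f x\<bar> \<partial>lborel)"
  unfolding ft_def by (rule order_trans[OF integral_norm_bound]) (simp add: norm_mult)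

lemma ft_add:
  fixes f g :: "'a::euclidean_space \<Rightarrow> real"
  assumes "integrable lborel f" "integrable lborel g"
  shows "ft (\<lambda>x. f x + g x) s = ft f s + ft g s"
  using assms by (simp add: ft_def ring_distribs integrable_cis_mult)

lemma ft_cmult:
  fixes f :: "'a::euclidean_space \<Rightarrow> real"
  shows "ft (\<lambda>x. c * f x) s = of_real c * ft f s"
  by (simp add: ft_def mult.left_commute[of _ "complex_of_real c"])

lemma ft_sum:
  fixes f :: "'b \<Rightarrow> 'a::euclidean_space \<Rightarrow> real"
  assumes "\<And>i. i \<in> I \<Longrightarrow> integrable lborel (f i)"
  shows "ft (\<lambda>x. \<Sum>i\<in>I. f i x) s = (\<Sum>i\<in>I. ft (f i) s)"
  using assms by (simp add: ft_def sum_distrib_left integrable_cis_mult)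

lemma integral_lborel_translate:
  fixes f :: "'a::euclidean_space \<Rightarrow> 'b::{banach, second_countable_topology}"
  assumes "f \<in> borel_measurable borel"
  shows "(\<integral>x. f (c + x) \<partial>lborel) = integral\<^sup>L lborel f"
proof -
  have "integral\<^sup>L lborel f = integral\<^sup>L (distr lborel borel ((+) c)) f"
    by (simp add: lborel_distr_plus)
  also have "\<dots> = (\<integral>x. f (c + x) \<partial>lborel)"
    using assms by (intro integral_distr) auto
  finally show ?thesis by simp
qed

lemma integrable_lborel_translate:
  fixes f :: "'a::euclidean_space \<Rightarrow> 'b::{banach, second_countable_topology}"
  assumes "integrable lborel f"
  shows "integrable lborel (\<lambda>x. f (c + x))"
proof -
  have "integrable (distr lborel borel ((+) c)) f"
    using assms by (simp add: lborel_distr_plus)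
  thus ?thesis
    using assms by (subst (asm) integrable_distr_eq) auto
qed

lemma ft_translate:
  fixes f :: "'a::euclidean_space \<Rightarrow> real"
  assumes [measurable]: "f \<in> borel_measurable borel"
  shows "ft (\<lambda>x. f (x - c)) s = cis (s \<bullet> c) * ft f s"
proof -
  have "ft (\<lambda>x. f (x - c)) s = (\<integral>x. cis (s \<bullet> (c + x)) * complex_of_real (f (c + x - c)) \<partial>lborel)"
    unfolding ft_def by (rule integral_lborel_translate[symmetric]) measurable
  also have "\<dots> = (\<integral>x. cis (s \<bullet> c) * (cis (s \<bullet> x) * complex_of_real (f x)) \<partial>lborel)"
    by (simp add: inner_add_right mult_ac flip: cis_mult)
  finally show ?thesis by (simp add: ft_def)
qed

text \<open>Continuity at 0, where the transform equals the integral of f, that is 1. Arguing by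
  contradiction yields a sequence, the form in which dominated convergence applies.\<close>

lemma ft_near_zero:
  fixes f :: "'a::euclidean_space \<Rightarrow> real"
  assumes f: "integrable lborel f" "integral\<^sup>L lborel f = 1"
  obtains \<epsilon> where "\<epsilon> > 0" "\<And>s. norm s \<le> \<epsilon> \<Longrightarrow> norm (ft f s) \<ge> 1/2"
proof -
  have "\<exists>\<epsilon>>0. \<forall>s. norm s \<le> \<epsilon> \<longrightarrow> norm (ft f s) \<ge> 1/2"
  proof (rule ccontr)
    assume "\<not> ?thesis"
    hence "\<forall>n. \<exists>s. norm s \<le> 1 / real (Suc n) \<and> norm (ft f s) < 1/2"
      by (metis not_le zero_less_divide_1_iff of_nat_0_less_iff zero_less_Suc)
    then obtain s where s: "\<And>n. norm (s n) \<le> 1 / real (Suc n)" "\<And>n. norm (ft f (s n)) < 1/2"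
      by metis
    have "(\<lambda>n. norm (s n)) \<longlonglongrightarrow> 0"
      by (rule real_tendsto_sandwich[OF _ _ tendsto_const LIMSEQ_Suc[OF lim_1_over_n]])
         (use s in \<open>auto intro!: always_eventually\<close>)
    hence s0: "s \<longlonglongrightarrow> 0" by (simp add: tendsto_norm_zero_iff)
    have "(\<lambda>n. ft f (s n)) \<longlonglongrightarrow> ft f 0"
      unfolding ft_def
    proof (rule integral_dominated_convergence)
      show "integrable lborel (\<lambda>x. \<bar>f x\<bar>)" using f by simp
      show "AE x in lborel. (\<lambda>i. cis (s i \<bullet> x) * complex_of_real (f x))
              \<longlonglongrightarrow> cis (0 \<bullet> x) * complex_of_real (f x)"
      proof (intro AE_I2 tendsto_mult_right)
        fix x :: 'a
        have "continuous_on UNIV cis" by (intro continuous_intros)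
        hence "isCont cis (0 \<bullet> x)" by (simp add: continuous_on_eq_continuous_at del: inner_zero_left)
        thus "(\<lambda>i. cis (s i \<bullet> x)) \<longlonglongrightarrow> cis (0 \<bullet> x)"
          by (rule isCont_tendsto_compose) (intro tendsto_intros s0)
      qed
      show "AE x in lborel. cmod (cis (s i \<bullet> x) * complex_of_real (f x)) \<le> \<bar>f x\<bar>" for i
        by (simp add: norm_mult)
    qed (use f in \<open>auto dest!: borel_measurable_integrable\<close>)
    hence "(\<lambda>n. norm (ft f (s n))) \<longlonglongrightarrow> norm (ft f 0)" by (rule tendsto_norm)
    moreover have "ft f 0 = 1" using f by (simp add: ft_def)
    ultimately have "norm (1::complex) \<le> (1/2::real)"
      using s(2) by (intro LIMSEQ_le_const2[where X="\<lambda>n. norm (ft f (s n))"]) (auto intro!: less_imp_le)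
    thus False by simp
  qed
  thus ?thesis using that by blast
qed

text \<open>The transform of \<open>x \<mapsto> f (x + e) - f x\<close>, computed in two ways, replaces integration by parts, so
  that no decay of \<open>f\<close> at infinity is needed.\<close>

lemma ft_directional_derivative:
  fixes f g :: "'a::euclidean_space \<Rightarrow> real"
  assumes deriv: "\<And>x t. ((\<lambda>t. f (x + t *\<^sub>R e)) has_real_derivative g (x + t *\<^sub>R e)) (at t)"
    and cont: "continuous_on UNIV g"
    and f: "integrable lborel f" and g: "integrable lborel g"
    and small: "\<bar>s \<bullet> e\<bar> < 1"
  shows "ft g s = - \<i> * of_real (s \<bullet> e) * ft f s"
proof -
  have [measurable]: "g \<in> borel_measurable borel" "f \<in> borel_measurable borel"
    using f g by auto
  define a where "a = s \<bullet> e"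
  \<comment> \<open>Averaging the translates over t in \<open>{0..1}\<close> multiplies
    \<open>ft g s\<close> by this factor. Kept as an integral it covers \<open>a = 0\<close>, where
    the closed form \<open>(cis (- a) - 1) / (- \<i> * a)\<close> would divide by 0.\<close>
  define I where "I = (\<integral>t. indicator {0..1} t *\<^sub>R cis (- (t * a)) \<partial>(lborel :: real measure))"
  define H where "H = (\<lambda>(t::real, x). indicator {0..1} t *\<^sub>R (cis (s \<bullet> x) * complex_of_real (g (x + t *\<^sub>R e))))"
  have H_meas: "H \<in> borel_measurable (lborel \<Otimes>\<^sub>M lborel)"
    unfolding H_def by measurable
  have tr: "(\<integral>x. cis (s \<bullet> x) * complex_of_real (g (x + t *\<^sub>R e)) \<partial>lborel) = cis (- (t * a)) * ft g s" for t
    using ft_translate[of g "- t *\<^sub>R e" s] by (simp add: ft_def a_def)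
  have int_tr: "integrable lborel (\<lambda>x. g (x + t *\<^sub>R e))" for t
    using integrable_lborel_translate[OF g, of "t *\<^sub>R e"] by (simp add: add.commute)
  have int_abs: "(\<integral>x. \<bar>g (x + t *\<^sub>R e)\<bar> \<partial>lborel) = (\<integral>x. \<bar>g x\<bar> \<partial>lborel)" for t
    using integral_lborel_translate[of "\<lambda>x. \<bar>g x\<bar>" "t *\<^sub>R e"] by (simp add: add.commute)
  have H_int: "integrable (lborel \<Otimes>\<^sub>M lborel) H"
  proof (rule lborel_pair.Fubini_integrable[OF H_meas])
    have "(\<lambda>t. \<integral>x. norm (H (t, x)) \<partial>lborel) = (\<lambda>t. indicator {0..1} t *\<^sub>R (\<integral>x. \<bar>g x\<bar> \<partial>lborel))"
      by (simp add: H_def norm_mult int_abs)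
    thus "integrable lborel (\<lambda>t. \<integral>x. norm (H (t, x)) \<partial>lborel)"
      by simp
    show "AE t in lborel. integrable lborel (\<lambda>x. H (t, x))"
      by (simp add: H_def integrable_cis_mult int_tr)
  qed
  have FTC: "(\<integral>t. indicator {0..1} t *\<^sub>R g (x + t *\<^sub>R e) \<partial>lborel) = f (x + e) - f x" for x
  proof -
    have "(\<integral>t. indicator {0..1} t *\<^sub>R g (x + t *\<^sub>R e) \<partial>lborel) = f (x + 1 *\<^sub>R e) - f (x + 0 *\<^sub>R e)"
    proof (rule integral_FTC_atLeastAtMost)
      show "continuous_on {0..1} (\<lambda>t. g (x + t *\<^sub>R e))"
        by (rule continuous_on_compose2[OF cont]) (auto intro!: continuous_intros)
      show "((\<lambda>t. f (x + t *\<^sub>R e)) has_vector_derivative g (x + t *\<^sub>R e)) (at t within {0..1})" for t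
        using deriv[of x t] has_real_derivative_iff_has_vector_derivative has_vector_derivative_at_within
        by blast
    qed simp
    thus ?thesis by simp
  qed
  \<comment> \<open>The double integral of \<open>H\<close> in two orders: over x first it
    transforms translates of g, over t first it is the fundamental theorem of calculus on the
    segment from x to \<open>x + e\<close>.\<close>
  have "I * ft g s = (\<integral>t. \<integral>x. H (t, x) \<partial>lborel \<partial>lborel)"
    unfolding I_def H_def by (simp add: tr flip: integral_mult_left_zero)
  also have "(\<integral>t. \<integral>x. H (t, x) \<partial>lborel \<partial>lborel) = (\<integral>x. \<integral>t. H (t, x) \<partial>lborel \<partial>lborel)"
    using lborel_pair.Fubini_integral[of "\<lambda>t x. H (t, x)"] H_int by simp
  also have "\<dots> = (\<integral>x. cis (s \<bullet> x) * complex_of_real (f (x + e) - f x) \<partial>lborel)"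
  proof (rule Bochner_Integration.integral_cong[OF refl])
    fix x
    have "(\<integral>t. H (t, x) \<partial>lborel)
        = (\<integral>t. cis (s \<bullet> x) * complex_of_real (indicator {0..1} t *\<^sub>R g (x + t *\<^sub>R e)) \<partial>lborel)"
      by (rule Bochner_Integration.integral_cong) (auto simp: H_def scaleR_conv_of_real)
    also have "\<dots> = cis (s \<bullet> x) * complex_of_real (f (x + e) - f x)"
      by (simp only: integral_mult_right_zero integral_complex_of_real FTC)
    finally show "(\<integral>t. H (t, x) \<partial>lborel) = cis (s \<bullet> x) * complex_of_real (f (x + e) - f x)" .
  qed
  also have "\<dots> = (cis (- a) - 1) * ft f s"
  proof -
    have "integrable lborel (\<lambda>x. f (x + e))"
      using integrable_lborel_translate[OF f, of e] by (simp add: add.commute)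
    hence "(\<integral>x. cis (s \<bullet> x) * complex_of_real (f (x + e) - f x) \<partial>lborel)
           = ft (\<lambda>x. f (x - (- e))) s - ft f s"
      using f by (simp add: ft_def ring_distribs integrable_cis_mult)
    thus ?thesis using ft_translate[of f "- e" s] by (simp add: a_def ring_distribs)
  qed
  finally have 1: "I * ft g s = (cis (- a) - 1) * ft f s" .
  have 2: "I * (- \<i> * of_real a) = cis (- a) - 1"
  proof -
    have "(\<integral>t. indicator {0..1} t *\<^sub>R (- \<i> * of_real a * cis (- (t * a))) \<partial>(lborel :: real measure))
       = cis (- (1 * a)) - cis (- (0 * a))"
    proof (rule integral_FTC_atLeastAtMost)
      show "((\<lambda>t. cis (- (t * a))) has_vector_derivative - \<i> * of_real a * cis (- (t * a))) (at t within {0..1})" for t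
        unfolding cis_conv_exp
        by (rule has_vector_derivative_real_field derivative_eq_intros | simp)+
    qed (auto intro!: continuous_intros)
    moreover have "(\<integral>t. indicator {0..1} t *\<^sub>R (- \<i> * of_real a * cis (- (t * a))) \<partial>(lborel :: real measure)) = I * (- \<i> * of_real a)"
      unfolding I_def integral_mult_left_zero[symmetric]
      by (rule Bochner_Integration.integral_cong) (auto simp: scaleR_conv_of_real)
    ultimately show ?thesis by simp
  qed
  \<comment> \<open>\<open>I\<close> vanishes exactly when a is a nonzero multiple of 2 pi, which
    \<open>small\<close> excludes.\<close>
  have "I \<noteq> 0"
  proof (cases "a = 0")
    case True thus ?thesis by (simp add: I_def)
  next
    case False
    have "\<bar>a\<bar> < 1" using small by (simp add: a_def)
    hence "sin a \<noteq> 0" using False pi_gt3 sin_eq_0_pi[of a] by linarith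
    hence "Im (cis (-a) - 1) \<noteq> 0" by simp
    thus ?thesis using 2 by (metis mult_zero_left zero_complex.simps(2))
  qed
  have "I * ft g s = I * (- \<i> * of_real a * ft f s)"
    by (metis 1 2 mult.assoc)
  thus ?thesis by (metis \<open>I \<noteq> 0\<close> a_def mult_left_cancel)
qed

text \<open>Fubini. By translation invariance the Lebesgue integral of
  \<open>\<bar>f0 (x - t)\<bar>\<close> does not depend on t, and constants are integrable under the
  probability measure \<nu>; joint integrability is therefore obtained with \<nu> as the outer
  measure and then swapped.\<close>

lemma
  fixes f0 :: "real^'d \<Rightarrow> real"
  assumes f0: "integrable lborel f0" and \<nu>: "\<nu> \<in> prob_on S"
  shows integrable_mixture: "integrable lborel (mixture f0 \<nu>)"
    and ft_mixture: "ft (mixture f0 \<nu>) s = ft f0 s * (\<integral>t. cis (s \<bullet> t) \<partial>\<nu>)"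
proof -
  interpret prob_space \<nu> using \<nu> by (simp add: prob_on_def)
  have [measurable_cong]: "sets \<nu> = sets borel" using \<nu> by (simp add: prob_on_def)
  have [measurable]: "f0 \<in> borel_measurable borel" using f0 by auto
  interpret P: pair_sigma_finite lborel \<nu> ..
  interpret P': pair_sigma_finite \<nu> lborel ..
  have tr_int: "integrable lborel (\<lambda>x. f0 (x - t))" for t
    using integrable_lborel_translate[OF f0, of "-t"] by simp
  have tr_norm: "(\<integral>x. \<bar>f0 (x - t)\<bar> \<partial>lborel) = (\<integral>x. \<bar>f0 x\<bar> \<partial>lborel)" for t
    using integral_lborel_translate[of "\<lambda>x. \<bar>f0 x\<bar>" "-t"] by simp
  have int': "integrable (\<nu> \<Otimes>\<^sub>M lborel) (\<lambda>(t, x). f0 (x - t))"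
    by (rule P'.Fubini_integrable) (auto simp: tr_norm tr_int)
  have int: "integrable (lborel \<Otimes>\<^sub>M \<nu>) (\<lambda>(x, t). f0 (x - t))"
    using P'.integrable_product_swap[OF int'] by (simp add: case_prod_beta)
  show "integrable lborel (mixture f0 \<nu>)"
    using P.integrable_fst'[OF int] by (simp add: mixture_def[abs_def] translate_def)
  have intc: "integrable (\<nu> \<Otimes>\<^sub>M lborel) (\<lambda>(t, x). cis (s \<bullet> x) * complex_of_real (f0 (x - t)))"
    by (rule P'.Fubini_integrable) (auto simp: tr_norm norm_mult tr_int integrable_cis_mult)
  have "ft (mixture f0 \<nu>) s = (\<integral>x. \<integral>t. cis (s \<bullet> x) * complex_of_real (f0 (x - t)) \<partial>\<nu> \<partial>lborel)"
    by (simp add: ft_def mixture_def translate_def)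
  also have "\<dots> = (\<integral>t. \<integral>x. cis (s \<bullet> x) * complex_of_real (f0 (x - t)) \<partial>lborel \<partial>\<nu>)"
    by (rule P'.Fubini_integral[OF intc])
  also have "\<dots> = (\<integral>t. cis (s \<bullet> t) * ft f0 s \<partial>\<nu>)"
    using ft_translate[of f0] by (simp add: ft_def)
  finally show "ft (mixture f0 \<nu>) s = ft f0 s * (\<integral>t. cis (s \<bullet> t) \<partial>\<nu>)"
    by simp
qed

subsection \<open>Trigonometric polynomials\<close>

text \<open>A list of pairs (coefficient, frequency) encodes \<open>\<Sum> c exp (i s \<bullet> t)\<close>.\<close>

type_synonym 'a trigpoly = "(complex \<times> 'a) list"

definition tval :: "'a::euclidean_space trigpoly \<Rightarrow> 'a \<Rightarrow> complex" where
  "tval p t = (\<Sum>(c, s)\<leftarrow>p. c * cis (s \<bullet> t))"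

text \<open>The derivative of \<open>tval p\<close> at t in direction v, written out term by term;
  \<open>thess\<close> is the second derivative in the same style. Working formally on lists, the
  product rules become inductions instead of calculus.\<close>

definition tgrad :: "'a::euclidean_space trigpoly \<Rightarrow> 'a \<Rightarrow> 'a \<Rightarrow> complex" where
  "tgrad p t v = (\<Sum>(c, s)\<leftarrow>p. c * (\<i> * of_real (s \<bullet> v)) * cis (s \<bullet> t))"

definition thess :: "'a::euclidean_space trigpoly \<Rightarrow> 'a \<Rightarrow> 'a \<Rightarrow> 'a \<Rightarrow> complex" where
  "thess p t v w = (\<Sum>(c, s)\<leftarrow>p. - c * of_real (s \<bullet> v) * of_real (s \<bullet> w) * cis (s \<bullet> t))"

text \<open>Equal frequencies in the list are not merged, so this depends on the list and not only
  on the function. It still dominates the supremum norm and is exactly multiplicative under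
  \<open>tmult\<close>.\<close>

definition weight :: "'a trigpoly \<Rightarrow> real" where
  "weight p = (\<Sum>(c, s)\<leftarrow>p. norm c)"

definition freq_le :: "real \<Rightarrow> 'a::euclidean_space trigpoly \<Rightarrow> bool" where
  "freq_le r p \<longleftrightarrow> (\<forall>(c, s)\<in>set p. norm s \<le> r)"

definition tmult :: "'a::euclidean_space trigpoly \<Rightarrow> 'a trigpoly \<Rightarrow> 'a trigpoly" where
  "tmult p q = concat (map (\<lambda>(c, s). map (\<lambda>(d, u). (c * d, s + u)) q) p)"

lemma trig_Nil [simp]:
  "tval [] t = 0" "tgrad [] t v = 0" "thess [] t v w = 0" "weight [] = 0" "freq_le r []"
  by (simp_all add: tval_def tgrad_def thess_def weight_def freq_le_def)

lemma trig_Cons [simp]: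
  "tval ((c, s) # p) t = c * cis (s \<bullet> t) + tval p t"
  "tgrad ((c, s) # p) t v = c * (\<i> * of_real (s \<bullet> v)) * cis (s \<bullet> t) + tgrad p t v"
  "thess ((c, s) # p) t v w = - c * of_real (s \<bullet> v) * of_real (s \<bullet> w) * cis (s \<bullet> t) + thess p t v w"
  "weight ((c, s) # p) = norm c + weight p"
  "freq_le r ((c, s) # p) \<longleftrightarrow> norm s \<le> r \<and> freq_le r p"
  by (simp_all add: tval_def tgrad_def thess_def weight_def freq_le_def)

lemma trig_append:
  "tval (p @ q) t = tval p t + tval q t"
  "tgrad (p @ q) t v = tgrad p t v + tgrad q t v"
  "thess (p @ q) t v w = thess p t v w + thess q t v w"
  "weight (p @ q) = weight p + weight q"
  "freq_le r (p @ q) \<longleftrightarrow> freq_le r p \<and> freq_le r q"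
  by (auto simp: tval_def tgrad_def thess_def weight_def freq_le_def)

lemma weight_nonneg: "0 \<le> weight p"
  unfolding weight_def by (intro sum_list_nonneg) auto

text \<open>The mapped list is one row of \<open>tmult\<close>, namely q times a single exponential;
  these Leibniz rules are the induction step for \<open>trig_mult\<close>.\<close>

lemma trig_shift:
  "tval (map (\<lambda>(d, u). (c * d, s + u)) q) t = c * cis (s \<bullet> t) * tval q t"
  "tgrad (map (\<lambda>(d, u). (c * d, s + u)) q) t v =
     c * cis (s \<bullet> t) * (\<i> * of_real (s \<bullet> v) * tval q t + tgrad q t v)"
  "thess (map (\<lambda>(d, u). (c * d, s + u)) q) t v w =
     c * cis (s \<bullet> t) * (- of_real (s \<bullet> v) * of_real (s \<bullet> w) * tval q t
       + \<i> * of_real (s \<bullet> v) * tgrad q t w + \<i> * of_real (s \<bullet> w) * tgrad q t v + thess q t v w)"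
  "weight (map (\<lambda>(d, u). (c * d, s + u)) q) = norm c * weight q"
  by (induction q) (auto simp: inner_add_left algebra_simps norm_mult simp flip: cis_mult)

lemma freq_le_shift: "freq_le r q \<Longrightarrow> norm s \<le> r' \<Longrightarrow> freq_le (r' + r) (map (\<lambda>(d, u). (c * d, s + u)) q)"
  by (induction q) (auto intro!: norm_triangle_mono)

lemma tmult_Nil [simp]: "tmult [] q = []"
  by (simp add: tmult_def)

lemma tmult_Cons [simp]: "tmult ((c, s) # p) q = map (\<lambda>(d, u). (c * d, s + u)) q @ tmult p q"
  by (simp add: tmult_def)

lemma trig_mult:
  "tval (tmult p q) t = tval p t * tval q t"
  "tgrad (tmult p q) t v = tval p t * tgrad q t v + tgrad p t v * tval q t"
  "thess (tmult p q) t v w = tval p t * thess q t v w + tgrad p t v * tgrad q t w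
      + tgrad p t w * tgrad q t v + thess p t v w * tval q t"
  "weight (tmult p q) = weight p * weight q"
  by (induction p) (auto simp: trig_append trig_shift algebra_simps)

lemma freq_le_mult: "freq_le r p \<Longrightarrow> freq_le r' q \<Longrightarrow> freq_le (r + r') (tmult p q)"
  by (induction p) (auto simp: trig_append freq_le_shift)

lemma freq_le_mono: "freq_le r p \<Longrightarrow> r \<le> r' \<Longrightarrow> freq_le r' p"
  by (auto simp: freq_le_def)

section \<open>Uniform estimates for values, Taylor remainders and gradients\<close>

lemma norm_tval_le: "norm (tval p t) \<le> weight p"
proof (induction p)
  case (Cons a p)
  obtain c s where "a = (c, s)" by force
  with Cons show ?case by (auto intro!: norm_triangle_mono simp: norm_mult)
qed simp

lemma norm_taylor_remainder_cis: "norm (cis x - 1 - \<i> * of_real x) \<le> x\<^sup>2"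
proof -
  have "norm (cis x - (1 + \<i> * of_real x)) \<le> x\<^sup>2 / 2"
    using iexp_approx1[of x 1] by (simp add: cis_conv_exp power2_eq_square)
  also have "\<dots> \<le> x\<^sup>2" by simp
  finally show ?thesis by (simp add: diff_diff_eq)
qed

text \<open>The term of frequency s contributes \<open>c * cis (s \<bullet> t0)\<close> times the
  remainder of \<open>cis\<close> at \<open>s \<bullet> (t - t0)\<close>. The bound holds for all t,
  so it can be integrated and yields a second moment.\<close>

lemma norm_taylor_remainder_tval:
  assumes "freq_le r p"
  shows "norm (tval p t - tval p t0 - tgrad p t0 (t - t0)) \<le> weight p * (r * norm (t - t0))\<^sup>2"
  using assms
proof (induction p)
  case (Cons a p)
  obtain c s where a: "a = (c, s)" by force
  have s: "norm s \<le> r" and IH: "norm (tval p t - tval p t0 - tgrad p t0 (t - t0)) \<le> weight p * (r * norm (t - t0))\<^sup>2"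
    using Cons a by auto
  define x where "x = s \<bullet> (t - t0)"
  have "\<bar>x\<bar> \<le> r * norm (t - t0)"
    unfolding x_def using Cauchy_Schwarz_ineq2[of s "t - t0"] s
    by (meson mult_right_mono norm_ge_zero order_trans)
  hence x2: "x\<^sup>2 \<le> (r * norm (t - t0))\<^sup>2"
    by (metis abs_ge_zero power_mono power2_abs)
  have "s \<bullet> t = s \<bullet> t0 + x" by (simp add: x_def inner_diff_right)
  hence "tval (a # p) t - tval (a # p) t0 - tgrad (a # p) t0 (t - t0)
      = c * cis (s \<bullet> t0) * (cis x - 1 - \<i> * of_real x) + (tval p t - tval p t0 - tgrad p t0 (t - t0))"
    by (simp add: a x_def[symmetric] ring_distribs flip: cis_mult)
  also have "norm \<dots> \<le> norm c * norm (cis x - 1 - \<i> * of_real x) + weight p * (r * norm (t - t0))\<^sup>2"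
    by (rule norm_triangle_mono) (use IH in \<open>auto simp: norm_mult\<close>)
  also have "\<dots> \<le> norm c * (r * norm (t - t0))\<^sup>2 + weight p * (r * norm (t - t0))\<^sup>2"
    using x2 norm_taylor_remainder_cis[of x]
    by (intro add_right_mono mult_left_mono) auto
  finally show ?case by (simp add: a ring_distribs)
qed simp

lemma tgrad_bound: "norm (tgrad p t v) \<le> weight p * r * norm v" if "freq_le r p"
  using that
proof (induction p)
  case (Cons a p)
  obtain c s where a: "a = (c, s)" by force
  have "\<bar>s \<bullet> v\<bar> \<le> r * norm v"
    using Cauchy_Schwarz_ineq2[of s v] Cons a
    by (auto intro: order_trans[OF _ mult_right_mono])
  hence "norm c * \<bar>s \<bullet> v\<bar> \<le> norm c * (r * norm v)"
    by (intro mult_left_mono) auto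
  with Cons show ?case
    by (auto simp: a norm_mult ring_distribs mult.assoc intro!: norm_triangle_mono)
qed simp

section \<open>Second-order terms: the Hessian traced against a positive semidefinite matrix\<close>

definition htr :: "real^'d^'d \<Rightarrow> (real^'d) trigpoly \<Rightarrow> real^'d \<Rightarrow> complex" where
  "htr R p t = (\<Sum>j\<in>UNIV. \<Sum>k\<in>UNIV. of_real (R $ j $ k) * thess p t (axis k 1) (axis j 1))"

lemma htr_Nil [simp]: "htr R [] t = 0"
  by (simp add: htr_def)

lemma inner_matrix_vector: "(s :: real^'d) \<bullet> (R *v s) = (\<Sum>j\<in>UNIV. \<Sum>k\<in>UNIV. R $ j $ k * (s $ k * s $ j))"
  by (simp add: inner_vec_def matrix_vector_mult_def sum_distrib_left mult_ac)

text \<open>The Hessian of an exponential of frequency s is minus the rank-one matrix of s times the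
  exponential, so its trace against R is a quadratic form.\<close>

lemma htr_Cons [simp]: "htr R ((c, s) # p) t = - c * of_real (s \<bullet> (R *v s)) * cis (s \<bullet> t) + htr R p t"
  by (simp add: htr_def ring_distribs sum.distrib inner_matrix_vector inner_axis sum_distrib_left
      sum_distrib_right sum_negf sum_subtractf mult_ac)

text \<open>In the Leibniz rule only the term with both derivatives on p survives, since p has a
  zero of order two at t.\<close>

lemma htr_mult_vanishing:
  assumes "tval p t = 0" "\<And>v. tgrad p t v = 0"
  shows "htr R (tmult p q) t = tval q t * htr R p t" "htr R (tmult q p) t = tval q t * htr R p t"
  using assms by (simp_all add: htr_def trig_mult sum_distrib_left mult_ac)

lemma psd_diag_nonneg: "R \<in> psd_matrices \<Longrightarrow> 0 \<le> R $ j $ j"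
proof -
  assume "R \<in> psd_matrices"
  hence "0 \<le> axis j 1 \<bullet> (R *v axis j 1)" by (auto simp: psd_matrices_def)
  thus ?thesis by (simp add: inner_axis' matrix_vector_mult_basis column_def)
qed

text \<open>Testing R on the sum and the difference of two basis vectors bounds every entry by the
  trace; adding up all entries gives the crude dimensional constant. Hence the trace alone controls
  all terms in which R occurs.\<close>

lemma psd_inner_le:
  fixes R :: "real^'d^'d"
  assumes R: "R \<in> psd_matrices"
  shows "s \<bullet> (R *v s) \<le> real (CARD('d))^2 * (norm s)\<^sup>2 * trace R"
proof -
  have sym: "R $ j $ k = R $ k $ j" for j k
    using R by (auto simp: psd_matrices_def transpose_def vec_eq_iff)
  have diag: "R $ j $ j \<le> trace R" for j
    unfolding trace_def by (rule member_le_sum) (auto simp: psd_diag_nonneg R)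
  have ent: "\<bar>R $ j $ k\<bar> \<le> trace R" for j k
  proof -
    have "0 \<le> (axis j 1 + c *\<^sub>R axis k 1) \<bullet> (R *v (axis j 1 + c *\<^sub>R axis k 1))" for c
      using R by (auto simp: psd_matrices_def)
    hence "0 \<le> R $ j $ j + 2 * c * R $ j $ k + c * c * R $ k $ k" for c
      by (simp add: matrix_vector_right_distrib inner_add_left inner_axis' matrix_vector_mult_basis
          column_def matrix_vector_mult_scaleR sym[of k j] algebra_simps)
    from this[of 1] this[of "-1"] diag[of j] diag[of k] show ?thesis by (simp add: abs_le_iff)
  qed
  have "s \<bullet> (R *v s) \<le> (\<Sum>j\<in>(UNIV::'d set). \<Sum>k\<in>(UNIV::'d set). trace R * (norm s * norm s))"
    unfolding inner_matrix_vector
  proof (intro sum_mono)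
    fix j k
    have "R $ j $ k * (s $ k * s $ j) \<le> \<bar>R $ j $ k\<bar> * (\<bar>s $ k\<bar> * \<bar>s $ j\<bar>)"
      by (metis abs_ge_self abs_mult)
    also have "\<dots> \<le> trace R * (norm s * norm s)"
      by (intro mult_mono ent component_le_norm_cart) (auto intro: order_trans[OF _ ent])
    finally show "R $ j $ k * (s $ k * s $ j) \<le> trace R * (norm s * norm s)" .
  qed
  also have "\<dots> = real (CARD('d))^2 * (norm s)\<^sup>2 * trace R"
    by (simp add: power2_eq_square)
  finally show ?thesis .
qed

lemma trace_psd_nonneg: "R \<in> psd_matrices \<Longrightarrow> 0 \<le> trace R"
  unfolding trace_def by (intro sum_nonneg psd_diag_nonneg)

lemma norm_htr_le:
  fixes R :: "real^'d^'d"
  assumes R: "R \<in> psd_matrices" and "freq_le r p"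
  shows "norm (htr R p t) \<le> weight p * (real (CARD('d))^2 * r\<^sup>2 * trace R)"
  using assms(2)
proof (induction p)
  case (Cons a p)
  obtain c s where a: "a = (c, s)" by force
  have "norm s \<le> r" using Cons a by simp
  have "0 \<le> s \<bullet> (R *v s)" using R by (simp add: psd_matrices_def)
  hence "\<bar>s \<bullet> (R *v s)\<bar> \<le> real (CARD('d))^2 * (norm s)\<^sup>2 * trace R"
    using psd_inner_le[OF R, of s] by simp
  also have "\<dots> \<le> real (CARD('d))^2 * r\<^sup>2 * trace R"
    by (intro mult_right_mono mult_left_mono power_mono) (auto simp: \<open>norm s \<le> r\<close> trace_psd_nonneg R)
  finally have "norm c * \<bar>s \<bullet> (R *v s)\<bar> \<le> norm c * (real (CARD('d))^2 * r\<^sup>2 * trace R)"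
    by (intro mult_left_mono) auto
  moreover have "norm (htr R (a # p) t) \<le> norm c * \<bar>s \<bullet> (R *v s)\<bar> + norm (htr R p t)"
    unfolding a htr_Cons by (rule order_trans[OF norm_triangle_ineq]) (simp add: norm_mult)
  ultimately show ?case using Cons a by (simp add: ring_distribs)
qed simp

section \<open>Test functions with prescribed zeros\<close>

definition one_minus_cos :: "'a::euclidean_space \<Rightarrow> 'a \<Rightarrow> 'a trigpoly" where
  "one_minus_cos s a = [(1, 0), (- cis (- (s \<bullet> a)) / 2, s), (- cis (s \<bullet> a) / 2, - s)]"

text \<open>Euler's formula for the sine of \<open>s \<bullet> (t - a)\<close>. Its zero at a is
  simple with gradient s: as a factor it removes the zeroth-order coefficient at a and exposes one
  component of the first-order one.\<close>

definition sine :: "'a::euclidean_space \<Rightarrow> 'a \<Rightarrow> 'a trigpoly" where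
  "sine s a = [(- \<i> * cis (- (s \<bullet> a)) / 2, s), (\<i> * cis (s \<bullet> a) / 2, - s)]"

lemma cis_plus_cis_minus: "cis x + cis (- x) = 2 * of_real (cos x)"
  by (simp add: complex_eq_iff)

lemma one_minus_cos_simps:
  "tval (one_minus_cos s a) t = of_real (1 - cos (s \<bullet> (t - a)))"
  "tval (one_minus_cos s a) a = 0"
  "tgrad (one_minus_cos s a) a v = 0"
  "weight (one_minus_cos s a) = 2"
  "norm s \<le> r \<Longrightarrow> freq_le r (one_minus_cos s a)"
proof -
  have "tval (one_minus_cos s a) t = 1 - (cis (s \<bullet> (t - a)) + cis (- (s \<bullet> (t - a)))) / 2"
    by (simp add: one_minus_cos_def cis_mult inner_diff_right diff_divide_distrib add_divide_distrib)
  thus "tval (one_minus_cos s a) t = of_real (1 - cos (s \<bullet> (t - a)))"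
    unfolding cis_plus_cis_minus by simp
  show "norm s \<le> r \<Longrightarrow> freq_le r (one_minus_cos s a)"
    by (auto simp: one_minus_cos_def intro: order_trans[OF norm_ge_zero])
qed (simp_all add: one_minus_cos_def cis_mult norm_divide)

text \<open>The Hessian of \<open>1 - cos (s \<bullet> (t - a))\<close> at a is the rank-one matrix
  of s.\<close>

lemma htr_one_minus_cos: "htr R (one_minus_cos s a) a = of_real (s \<bullet> (R *v s))"
proof -
  have "s \<bullet> (R *v (- s)) = - (s \<bullet> (R *v s))"
    using matrix_vector_mult_scaleR[of R "- 1" s] by simp
  moreover have "cis (s \<bullet> a) * cis (- (s \<bullet> a)) = 1"
    by (simp add: cis_mult)
  ultimately show ?thesis
    by (simp add: one_minus_cos_def mult_ac)
qed

lemma sine_simps: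
  "tval (sine s a) a = 0"
  "tgrad (sine s a) a v = of_real (s \<bullet> v)"
  "weight (sine s a) = 1"
  "norm s \<le> r \<Longrightarrow> freq_le r (sine s a)"
  by (simp_all add: sine_def cis_mult norm_mult norm_divide mult_ac)

text \<open>The value of \<open>bump\<close> is nonnegative and vanishes to second order at each \<open>\<theta> k\<close>. In its pairing
  with the parameters, \<open>\<eta>\<close> and \<open>\<beta>\<close> therefore drop out and only nonnegative terms remain.\<close>

definition bump :: "(nat \<Rightarrow> 'a::euclidean_space) \<Rightarrow> (nat \<Rightarrow> 'a) \<Rightarrow> nat list \<Rightarrow> 'a trigpoly" where
  "bump \<theta> s ks = foldr (\<lambda>k. tmult (one_minus_cos (s k) (\<theta> k))) ks [(1, 0)]"

lemma bump_Nil [simp]: "bump \<theta> s [] = [(1, 0)]"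
  and bump_Cons [simp]: "bump \<theta> s (k # ks) = tmult (one_minus_cos (s k) (\<theta> k)) (bump \<theta> s ks)"
  by (simp_all add: bump_def)

lemma tval_bump:
  "distinct ks \<Longrightarrow> tval (bump \<theta> s ks) t = of_real (\<Prod>k\<in>set ks. 1 - cos (s k \<bullet> (t - \<theta> k)))"
  by (induction ks) (auto simp: trig_mult one_minus_cos_simps)

lemma weight_bump: "weight (bump \<theta> s ks) = 2 ^ length ks"
  by (induction ks) (auto simp: trig_mult one_minus_cos_simps)

lemma freq_le_bump:
  assumes "\<And>k. k \<in> set ks \<Longrightarrow> norm (s k) \<le> r"
  shows "freq_le (real (length ks) * r) (bump \<theta> s ks)"
  using assms
proof (induction ks)
  case (Cons k ks)
  hence "freq_le (r + real (length ks) * r) (bump \<theta> s (k # ks))"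
    unfolding bump_Cons by (intro freq_le_mult one_minus_cos_simps) auto
  thus ?case by (simp add: ring_distribs)
qed simp

lemma bump_vanishes:
  assumes "k \<in> set ks"
  shows "tval (bump \<theta> s ks) (\<theta> k) = 0" "tgrad (bump \<theta> s ks) (\<theta> k) v = 0"
  using assms by (induction ks) (auto simp: trig_mult one_minus_cos_simps)

text \<open>The factor with index i has a double zero at \<open>\<theta> i\<close>, so both
  derivatives must fall on it and the others are merely evaluated. In the induction the double zero
  sits in the head if \<open>k = i\<close> and in the tail otherwise.\<close>

lemma htr_bump:
  assumes "distinct ks" "i \<in> set ks"
  shows "htr R (bump \<theta> s ks) (\<theta> i)
    = of_real ((\<Prod>k\<in>set ks - {i}. 1 - cos (s k \<bullet> (\<theta> i - \<theta> k))) * (s i \<bullet> (R *v s i)))"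
  using assms
proof (induction ks)
  case (Cons k ks)
  show ?case
  proof (cases "k = i")
    case True
    with Cons.prems show ?thesis
      by (simp add: htr_mult_vanishing one_minus_cos_simps tval_bump htr_one_minus_cos)
  next
    case False
    with Cons have i: "i \<in> set ks" and "set (k # ks) - {i} = insert k (set ks - {i})" by auto
    thus ?thesis using Cons False
      by (simp add: htr_mult_vanishing(2)[OF bump_vanishes[OF i]] one_minus_cos_simps)
  qed
qed simp

subsection \<open>The parameters as a distribution\<close>

text \<open>The parameters act on test functions as a distribution of order two, whose convolution with
  \<open>f0\<close> is \<open>mixture_density\<close>.\<close>

fun pairing :: "nat \<Rightarrow> (nat \<Rightarrow> real^'d) \<Rightarrow> 'd params \<Rightarrow> (real^'d) trigpoly \<Rightarrow> complex" where
  "pairing q \<theta> (\<eta>, \<beta>, \<rho>, \<tau>, \<nu>) p =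
     of_real (\<tau> 0) * (\<integral>t. tval p t \<partial>\<nu> 0) +
     (\<Sum>i=1..q. of_real (\<eta> i) * tval p (\<theta> i) + tgrad p (\<theta> i) (\<beta> i) + htr (\<rho> i) p (\<theta> i)
        + of_real (\<tau> i) * (\<integral>t. tval p t \<partial>\<nu> i))"

lemma tval_fun:
  "tval [] = (\<lambda>t. 0)" "tval ((c, s) # p) = (\<lambda>t. c * cis (s \<bullet> t) + tval p t)"
  by (simp_all add: fun_eq_iff)

lemma continuous_on_tval: "continuous_on S (tval p)"
proof (induction p)
  case (Cons a p)
  thus ?case by (cases a) (auto intro!: continuous_intros)
qed simp

lemma integrable_tval:
  assumes "\<nu> \<in> prob_on S"
  shows "integrable \<nu> (tval p)"
proof -
  interpret prob_space \<nu> using assms by (simp add: prob_on_def)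
  have sets: "sets \<nu> = sets borel" using assms by (simp add: prob_on_def)
  have "tval p \<in> borel_measurable borel"
    by (rule borel_measurable_continuous_onI[OF continuous_on_tval])
  hence "tval p \<in> borel_measurable \<nu>" using measurable_cong_sets[OF sets refl] by blast
  thus ?thesis by (intro integrable_const_bound[of _ "weight p"]) (auto simp: norm_tval_le)
qed

lemma pairing_Nil [simp]: "pairing q \<theta> P [] = 0"
  by (cases P) (simp add: tval_fun)

text \<open>Linearity in the polynomial, in the shape that reduces estimates to single exponentials
  by induction on the list. Membership in \<open>param_set\<close> supplies the integrability of
  \<open>tval\<close> under each \<open>\<nu> i\<close>.\<close>

lemma pairing_Cons:
  assumes "P \<in> param_set q A"
  shows "pairing q \<theta> P ((c, s) # p) = c * pairing q \<theta> P [(1, s)] + pairing q \<theta> P p"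
proof -
  obtain \<eta> \<beta> \<rho> \<tau> \<nu> where P: "P = (\<eta>, \<beta>, \<rho>, \<tau>, \<nu>)" by (cases P)
  define J where "J i p = (\<integral>t. tval p t \<partial>\<nu> i)" for i p
  have J: "J i ((c, s) # p) = c * J i [(1, s)] + J i p"
    if "i \<in> {0..q}" for i
  proof -
    have \<nu>: "\<nu> i \<in> prob_on (A i)" using assms that by (auto simp: P param_set_def)
    show ?thesis
      using integrable_tval[OF \<nu>, of "[(1, s)]"] integrable_tval[OF \<nu>, of p]
      by (simp add: J_def tval_fun)
  qed
  have pairing: "pairing q \<theta> P p = of_real (\<tau> 0) * J 0 p +
     (\<Sum>i=1..q. of_real (\<eta> i) * tval p (\<theta> i) + tgrad p (\<theta> i) (\<beta> i) + htr (\<rho> i) p (\<theta> i)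
        + of_real (\<tau> i) * J i p)" for p
    by (simp add: P J_def)
  show ?thesis
    by (simp add: pairing J sum.distrib sum_distrib_left algebra_simps sum_subtractf sum_negf)
qed

section \<open>The convolution with \<open>f0\<close> and its Fourier transform\<close>

definition mixture_density ::
  "(real^'d \<Rightarrow> real) \<Rightarrow> nat \<Rightarrow> (nat \<Rightarrow> real^'d) \<Rightarrow> 'd params \<Rightarrow> real^'d \<Rightarrow> real" where
  "mixture_density f0 q \<theta> P x = (case P of (\<eta>, \<beta>, \<rho>, \<tau>, \<nu>) \<Rightarrow>
     \<tau> 0 * mixture f0 (\<nu> 0) x +
     (\<Sum>i=1..q. \<eta> i * translate f0 (\<theta> i) x + \<beta> i \<bullet> D1 f0 (\<theta> i) x
        + trace (\<rho> i ** D2 f0 (\<theta> i) x) + \<tau> i * mixture f0 (\<nu> i) x))"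

lemma trace_mult_scaleR: "trace (R ** (c *\<^sub>R D)) = c * trace (R ** (D :: real^'d^'d))"
  by (simp add: trace_def matrix_matrix_mult_def sum_distrib_left mult_ac)

text \<open>The weight in \<open>L1_norm fs\<close> cancels the denominators in \<open>ell\<close>,
  leaving an ordinary Lebesgue integral in which \<open>fs\<close> no longer occurs.\<close>

lemma ell_times_density:
  assumes "fs x \<noteq> 0"
  shows "ell f0 fs q \<theta> P x * fs x = mixture_density f0 q \<theta> P x"
proof -
  have "inverse (fs x) * y * fs x = y" for y using assms by simp
  note this [simp]
  show ?thesis using assms
    by (cases P) (simp add: mixture_density_def trace_mult_scaleR ring_distribs sum_distrib_right)
qed

lemma differentiable_on_UNIV_derivs:
  fixes f :: "real^'d \<Rightarrow> real"
  assumes "f differentiable_on UNIV"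
  shows "((\<lambda>t. f (y + t *\<^sub>R axis i 1)) has_real_derivative partial_deriv i f (y + t *\<^sub>R axis i 1)) (at t)"
proof -
  define z where "z = y + t *\<^sub>R axis i 1"
  obtain D where D: "(f has_derivative D) (at z)"
    using assms by (auto simp: differentiable_on_def differentiable_def)
  interpret D: bounded_linear D using D by (rule has_derivative_bounded_linear)
  \<comment> \<open>Stated for every parametrization of the line through z: with base point z and
    parameter 0 it evaluates \<open>partial_deriv\<close>, with base point y and parameter t it is
    the claim.\<close>
  have line: "((\<lambda>t. f (w + t *\<^sub>R axis i 1)) has_real_derivative D (axis i 1)) (at u)"
    if "w + u *\<^sub>R axis i 1 = z" for w u
  proof -
    have "((\<lambda>t. f (w + t *\<^sub>R axis i 1)) has_derivative (\<lambda>h. D (h *\<^sub>R axis i 1))) (at u)"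
      by (rule has_derivative_compose[where g = f]) (auto intro!: derivative_eq_intros simp: that D)
    thus ?thesis by (simp add: has_field_derivative_def D.scaleR mult_commute_abs)
  qed
  have "partial_deriv i f z = D (axis i 1)"
    unfolding partial_deriv_def by (rule DERIV_imp_deriv, rule line) simp
  thus ?thesis using line[of y t] by (simp add: z_def)
qed

lemma partial_deriv_reflect:
  fixes f :: "real^'d \<Rightarrow> real"
  assumes "f differentiable_on UNIV"
  shows "partial_deriv i (\<lambda>y. f (x - y)) y = - partial_deriv i f (x - y)"
proof -
  have "((\<lambda>t. f ((x - y) + t *\<^sub>R axis i 1)) has_real_derivative partial_deriv i f (x - y)) (at (- 0))"
    using differentiable_on_UNIV_derivs[OF assms, of "x - y" i 0] by simp
  hence "((\<lambda>t. f ((x - y) + (- t) *\<^sub>R axis i 1)) has_real_derivative - partial_deriv i f (x - y)) (at 0)"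
    by (subst (asm) DERIV_mirror) simp
  thus ?thesis
    unfolding partial_deriv_def by (intro DERIV_imp_deriv) (simp add: diff_diff_eq)
qed

lemma partial_deriv_uminus:
  "g differentiable_on UNIV \<Longrightarrow> partial_deriv i (\<lambda>y. - g y) (y::real^'d) = - partial_deriv i g (y::real^'d)"
  using differentiable_on_UNIV_derivs[of g y i 0]
  by (auto simp: partial_deriv_def intro!: DERIV_imp_deriv DERIV_minus)

text \<open>The parameter enters through \<open>x - \<theta>\<close>, so each differentiation
  contributes a sign: one in \<open>D1\<close>, two in \<open>D2\<close>, where they cancel.\<close>

lemma
  assumes "Ck 2 f0"
  shows D1_eq: "D1 f0 \<theta> x $ i = - partial_deriv i f0 (x - \<theta>)"
    and D2_eq: "D2 f0 \<theta> x $ i $ j = partial_deriv i (partial_deriv j f0) (x - \<theta>)"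
    and Ck2_diff: "f0 differentiable_on UNIV" "partial_deriv i f0 differentiable_on UNIV"
    and Ck2_continuous_derivs: "continuous_on UNIV (partial_deriv i f0)"
       "continuous_on UNIV (partial_deriv i (partial_deriv j f0))"
proof -
  have diff: "f0 differentiable_on UNIV" "partial_deriv i f0 differentiable_on UNIV"
     "continuous_on UNIV (partial_deriv i (partial_deriv j f0))" for i j
    using assms by (simp_all add: numeral_2_eq_2)
  show "f0 differentiable_on UNIV" "partial_deriv i f0 differentiable_on UNIV"
     "continuous_on UNIV (partial_deriv i (partial_deriv j f0))" by (fact diff)+
  show "continuous_on UNIV (partial_deriv i f0)"
    by (intro differentiable_imp_continuous_on diff)
  show D1: "D1 f0 \<theta> x $ i = - partial_deriv i f0 (x - \<theta>)"
    by (simp add: D1_def translate_def partial_deriv_reflect diff)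
  have D1': "partial_deriv j (\<lambda>y. f0 (x - y)) = (\<lambda>y. - partial_deriv j f0 (x - y))"
    by (simp add: partial_deriv_reflect diff fun_eq_iff)
  have "(\<lambda>y. partial_deriv j f0 (x - y)) differentiable_on UNIV"
    unfolding differentiable_on_def
  proof
    fix y
    have "partial_deriv j f0 differentiable at (x - y)"
      using diff(2)[of j] by (simp add: differentiable_on_def)
    thus "(\<lambda>y. partial_deriv j f0 (x - y)) differentiable at y"
      by (rule differentiable_compose) (auto intro!: derivative_intros)
  qed
  thus "D2 f0 \<theta> x $ i $ j = partial_deriv i (partial_deriv j f0) (x - \<theta>)"
    by (simp add: D2_def translate_def D1' partial_deriv_uminus partial_deriv_reflect diff)
qed

text \<open>Every summand transforms into \<open>ft f0 s\<close> times a multiplier: a phase for a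
  translation, \<open>- \<i>\<close> times a component of s for each derivative, and the integrated
  phase for a mixture. The multipliers add up to the pairing with one exponential. The condition
  \<open>norm s < 1\<close> makes the derivative rule available along every axis.\<close>

lemma
  fixes f0 :: "real^'d \<Rightarrow> real"
  assumes C2: "Ck 2 f0"
    and f0: "integrable lborel f0"
    and I1: "\<And>i. integrable lborel (partial_deriv i f0)"
    and I2: "\<And>i j. integrable lborel (partial_deriv i (partial_deriv j f0))"
    and P: "P \<in> param_set q A"
  shows integrable_mixture_density: "integrable lborel (mixture_density f0 q \<theta> P)"
    and ft_mixture_density:
      "norm s < 1 \<Longrightarrow> ft (mixture_density f0 q \<theta> P) s = ft f0 s * pairing q \<theta> P [(1, s)]"
proof -
  obtain \<eta> \<beta> \<rho> \<tau> \<nu> where P_eq: "P = (\<eta>, \<beta>, \<rho>, \<tau>, \<nu>)" by (cases P)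
  have \<nu>: "\<nu> i \<in> prob_on (A i)" if "i \<in> {0..q}" for i
    using P that by (auto simp: P_eq param_set_def)
  have tr: "integrable lborel (\<lambda>x. g (x - c))" if "integrable lborel g" for g :: "real^'d \<Rightarrow> real" and c
    using integrable_lborel_translate[OF that, of "-c"] by simp
  have mix: "integrable lborel (mixture f0 (\<nu> i))" if "i \<in> {0..q}" for i
    by (rule integrable_mixture[OF f0 \<nu>[OF that]])
  have D1: "\<beta> i \<bullet> D1 f0 (\<theta> i) x = (\<Sum>j\<in>UNIV. - \<beta> i $ j * partial_deriv j f0 (x - \<theta> i))" for i x
    by (simp add: inner_vec_def D1_eq[OF C2])
  have D2: "trace (\<rho> i ** D2 f0 (\<theta> i) x) =
     (\<Sum>j\<in>UNIV. \<Sum>k\<in>UNIV. \<rho> i $ j $ k * partial_deriv k (partial_deriv j f0) (x - \<theta> i))" for i x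
    by (simp add: trace_def matrix_matrix_mult_def D2_eq[OF C2])
  have density: "mixture_density f0 q \<theta> P = (\<lambda>x. \<tau> 0 * mixture f0 (\<nu> 0) x +
     (\<Sum>i=1..q. \<eta> i * f0 (x - \<theta> i) + (\<Sum>j\<in>UNIV. - \<beta> i $ j * partial_deriv j f0 (x - \<theta> i))
        + (\<Sum>j\<in>UNIV. \<Sum>k\<in>UNIV. \<rho> i $ j $ k * partial_deriv k (partial_deriv j f0) (x - \<theta> i))
        + \<tau> i * mixture f0 (\<nu> i) x))"
    by (simp add: mixture_density_def P_eq D1 D2 translate_def fun_eq_iff)
  note ints = Bochner_Integration.integrable_add Bochner_Integration.integrable_mult_right
    Bochner_Integration.integrable_sum tr f0 I1 I2 mix
  show "integrable lborel (mixture_density f0 q \<theta> P)"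
    unfolding density by (intro ints) auto
  assume s: "norm s < 1"
  have small: "\<bar>s \<bullet> axis j 1\<bar> < 1" for j
    using component_le_norm_cart[of s j] s by (simp add: inner_axis)
  have ft1: "ft (partial_deriv j f0) s = - \<i> * of_real (s $ j) * ft f0 s" for j
    using ft_directional_derivative[OF differentiable_on_UNIV_derivs[OF Ck2_diff(1)[OF C2]]
        Ck2_continuous_derivs(1)[OF C2] f0 I1 small]
    by (simp add: inner_axis)
  have ft2: "ft (partial_deriv k (partial_deriv j f0)) s = - of_real (s $ k * s $ j) * ft f0 s" for j k
    using ft_directional_derivative[OF differentiable_on_UNIV_derivs[OF Ck2_diff(2)[OF C2]]
        Ck2_continuous_derivs(2)[OF C2] I1 I2 small]
    by (simp add: inner_axis ft1 algebra_simps)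
  have [measurable]: "f0 \<in> borel_measurable borel" "partial_deriv j f0 \<in> borel_measurable borel"
    "partial_deriv k (partial_deriv j f0) \<in> borel_measurable borel" for j k
    using f0 I1[of j] I2[of k j] by auto
  have pair: "pairing q \<theta> P [(1, s)] = of_real (\<tau> 0) * (\<integral>t. cis (s \<bullet> t) \<partial>\<nu> 0) +
     (\<Sum>i=1..q. of_real (\<eta> i) * cis (s \<bullet> \<theta> i) + \<i> * of_real (s \<bullet> \<beta> i) * cis (s \<bullet> \<theta> i)
        - of_real (s \<bullet> (\<rho> i *v s)) * cis (s \<bullet> \<theta> i) + of_real (\<tau> i) * (\<integral>t. cis (s \<bullet> t) \<partial>\<nu> i))"
    by (simp add: P_eq tval_fun)
  have "ft (mixture_density f0 q \<theta> P) s = of_real (\<tau> 0) * ft (mixture f0 (\<nu> 0)) s +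
     (\<Sum>i=1..q. of_real (\<eta> i) * ft (\<lambda>x. f0 (x - \<theta> i)) s
        + (\<Sum>j\<in>UNIV. of_real (- \<beta> i $ j) * ft (\<lambda>x. partial_deriv j f0 (x - \<theta> i)) s)
        + (\<Sum>j\<in>UNIV. \<Sum>k\<in>UNIV. of_real (\<rho> i $ j $ k) * ft (\<lambda>x. partial_deriv k (partial_deriv j f0) (x - \<theta> i)) s)
        + of_real (\<tau> i) * ft (mixture f0 (\<nu> i)) s)"
    unfolding density
    apply (subst ft_add)
      apply (intro ints; simp)
     apply (intro ints; simp)
    apply (subst ft_sum)
     apply (intro ints; simp)
    apply (rule arg_cong2[where f = "(+)"])
     apply (rule ft_cmult)
    apply (rule sum.cong[OF refl])
    apply (subst ft_add, (intro ints; simp), (intro ints; simp))+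
    apply (subst ft_sum, (intro ints; simp))+
    apply (simp only: ft_cmult)
    done
  also have "\<dots> = ft f0 s * pairing q \<theta> P [(1, s)]"
  proof -
    have t2: "(\<Sum>j\<in>UNIV. of_real (- \<beta> i $ j) * ft (\<lambda>x. partial_deriv j f0 (x - \<theta> i)) s)
       = ft f0 s * (\<i> * of_real (s \<bullet> \<beta> i) * cis (s \<bullet> \<theta> i))" for i
      by (simp add: ft_translate ft1 inner_vec_def sum_distrib_left sum_distrib_right mult_ac)
    have t3: "(\<Sum>j\<in>UNIV. \<Sum>k\<in>UNIV. of_real (\<rho> i $ j $ k) * ft (\<lambda>x. partial_deriv k (partial_deriv j f0) (x - \<theta> i)) s)
       = - ft f0 s * (of_real (s \<bullet> (\<rho> i *v s)) * cis (s \<bullet> \<theta> i))" for i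
      by (simp add: ft_translate ft2 inner_matrix_vector sum_distrib_left sum_distrib_right mult_ac sum_negf)
    have t4: "ft (mixture f0 (\<nu> i)) s = ft f0 s * (\<integral>t. cis (s \<bullet> t) \<partial>\<nu> i)" if "i \<in> {0..q}" for i
      by (rule ft_mixture[OF f0 \<nu>[OF that]])
    show ?thesis
      unfolding pair t2 t3
      by (simp add: t4 ft_translate ring_distribs sum_distrib_left mult_ac)
  qed
  finally show "ft (mixture_density f0 q \<theta> P) s = ft f0 s * pairing q \<theta> P [(1, s)]" .
qed

subsection \<open>Test functions\<close>

text \<open>A bound for the distribution in the norm dual to \<open>weight\<close>, restricted to
  low frequencies. It isolates all that later estimates use of \<open>f0\<close>; in the end M is
  twice the integral of \<open>\<bar>L\<bar>\<close>.\<close>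

definition pairing_bounded :: "real \<Rightarrow> nat \<Rightarrow> (nat \<Rightarrow> real^'d) \<Rightarrow> 'd params \<Rightarrow> real \<Rightarrow> bool" where
  "pairing_bounded \<epsilon> q \<theta> P M \<longleftrightarrow> (\<forall>p. freq_le \<epsilon> p \<longrightarrow> norm (pairing q \<theta> P p) \<le> weight p * M)"

lemma pairing_bounded_nonneg:
  assumes "pairing_bounded \<epsilon> q \<theta> P M" "\<epsilon> \<ge> 0"
  shows "M \<ge> 0"
proof -
  have "norm (pairing q \<theta> P [(1, 0)]) \<le> M"
    using assms(1)[unfolded pairing_bounded_def, rule_format, of "[(1, 0)]"] assms(2) by simp
  thus ?thesis using norm_ge_zero order_trans by blast
qed

lemma one_minus_cos_prod_nonneg: "0 \<le> (\<Prod>k\<in>K. 1 - cos (x k :: real))"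
  by (intro prod_nonneg) auto

text \<open>Paired with a bump, the parameters give the sum of the numbers \<open>X i\<close> and
  \<open>Y i\<close> below. All are nonnegative, so each is at most the total, which is at most M
  times the weight \<open>2 ^ q\<close> of the bump.\<close>

lemma
  fixes s :: "nat \<Rightarrow> real^'d"
  assumes P: "(\<eta>, \<beta>, \<rho>, \<tau>, \<nu>) \<in> param_set q A"
    and bdd: "pairing_bounded \<epsilon> q \<theta> (\<eta>, \<beta>, \<rho>, \<tau>, \<nu>) M"
    and s: "\<And>k. k \<in> {1..q} \<Longrightarrow> norm (s k) \<le> \<delta>" and \<delta>: "real q * \<delta> \<le> \<epsilon>"
  shows bump_bounds_measure:
      "i \<in> {0..q} \<Longrightarrow> \<tau> i * (\<integral>t. (\<Prod>k=1..q. 1 - cos (s k \<bullet> (t - \<theta> k))) \<partial>\<nu> i) \<le> 2 ^ q * M"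
    and bump_bounds_psd:
      "i \<in> {1..q} \<Longrightarrow> (\<Prod>k\<in>{1..q} - {i}. 1 - cos (s k \<bullet> (\<theta> i - \<theta> k))) * (s i \<bullet> (\<rho> i *v s i)) \<le> 2 ^ q * M"
proof -
  define W where "W t = (\<Prod>k=1..q. 1 - cos (s k \<bullet> (t - \<theta> k)))" for t
  define X where "X i = (\<Prod>k\<in>{1..q} - {i}. 1 - cos (s k \<bullet> (\<theta> i - \<theta> k))) * (s i \<bullet> (\<rho> i *v s i))" for i
  define Y where "Y i = \<tau> i * (\<integral>t. W t \<partial>\<nu> i)" for i
  define p where "p = bump \<theta> s [1..<Suc q]"
  have set: "set [1..<Suc q] = {1..q}" by auto
  have val: "tval p = (\<lambda>t. of_real (W t))"
  proof
    fix t
    show "tval p t = of_real (W t)"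
      using tval_bump[of "[1..<Suc q]" \<theta> s t, unfolded set] by (simp add: p_def W_def del: upt_Suc)
  qed
  have "pairing q \<theta> (\<eta>, \<beta>, \<rho>, \<tau>, \<nu>) p = of_real (Y 0) + (\<Sum>i=1..q. of_real (X i) + of_real (Y i))"
    unfolding pairing.simps
  proof (intro arg_cong2[where f = "(+)"] sum.cong refl)
    fix i assume i: "i \<in> {1..q}"
    hence i': "i \<in> set [1..<Suc q]" by auto
    show "of_real (\<eta> i) * tval p (\<theta> i) + tgrad p (\<theta> i) (\<beta> i) + htr (\<rho> i) p (\<theta> i) = of_real (X i)"
      using bump_vanishes[OF i', of \<theta> s] htr_bump[OF distinct_upt i', of "\<rho> i" \<theta> s]
      unfolding set p_def[symmetric] X_def by simp
  qed (simp_all add: val Y_def)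
  also have "\<dots> = of_real (Y 0 + (\<Sum>i=1..q. X i + Y i))" by simp
  finally have pair: "pairing q \<theta> (\<eta>, \<beta>, \<rho>, \<tau>, \<nu>) p = of_real (Y 0 + (\<Sum>i=1..q. X i + Y i))" .
  have "freq_le (real (length [1..<Suc q]) * \<delta>) p"
    unfolding p_def by (intro freq_le_bump s) auto
  moreover have "real (length [1..<Suc q]) * \<delta> \<le> \<epsilon>" using \<delta> by (simp del: upt_Suc)
  ultimately have "freq_le \<epsilon> p" by (rule freq_le_mono)
  hence "norm (pairing q \<theta> (\<eta>, \<beta>, \<rho>, \<tau>, \<nu>) p) \<le> weight p * M"
    using bdd by (auto simp: pairing_bounded_def)
  moreover have "weight p = 2 ^ q" by (simp add: p_def weight_bump del: upt_Suc)
  ultimately have total: "Y 0 + (\<Sum>i=1..q. X i + Y i) \<le> 2 ^ q * M"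
    by (metis norm_of_real pair abs_ge_self order_trans)
  have Y: "0 \<le> Y i" if "i \<in> {0..q}" for i
    using P that unfolding Y_def W_def param_set_def
    by (intro mult_nonneg_nonneg integral_nonneg_AE AE_I2 one_minus_cos_prod_nonneg) auto
  have X: "0 \<le> X i" if "i \<in> {1..q}" for i
    using P that unfolding X_def param_set_def psd_matrices_def
    by (intro mult_nonneg_nonneg one_minus_cos_prod_nonneg) auto
  have le: "X i + Y i \<le> (\<Sum>i=1..q. X i + Y i)" if "i \<in> {1..q}" for i
    using that X Y by (intro member_le_sum) (auto intro!: add_nonneg_nonneg)
  have nn: "0 \<le> (\<Sum>i=1..q. X i + Y i)"
    using X Y by (intro sum_nonneg add_nonneg_nonneg) auto
  show "X i \<le> 2 ^ q * M" if "i \<in> {1..q}"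
    using le[OF that] Y[of i] Y[of 0] that total by simp
  show "Y i \<le> 2 ^ q * M" if "i \<in> {0..q}"
    using le[of i] Y[of 0] X[of i] that total nn by (cases "i = 0") auto
qed

section \<open>Averaging over frequencies\<close>

lemma one_minus_sinc_ge:
  fixes z :: real
  assumes "0 < z"
  shows "min 1 (z\<^sup>2) / 10 \<le> 1 - sin z / z"
\<comment> \<open>Up to 2, Taylor's formula leaves at least 1/6 - 4/120 = 2/15 times the square of
  z; beyond 2 the difference is at least 1/2. The constant 1/10 lies below both.\<close>
proof (cases "z \<le> 2")
  case True
  have "(\<Sum>m<5. sin_coeff m * z ^ m) = z - z ^ 3 / 6"
  proof -
    have "{..<5::nat} = {0, 1, 2, 3, 4}" by auto
    thus ?thesis by (simp add: sin_coeff_def fact_numeral)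
  qed
  hence "\<bar>sin z - (z - z ^ 3 / 6)\<bar> \<le> z ^ 5 / 120"
    using Maclaurin_sin_bound[of z 5] assms by (simp add: fact_numeral)
  hence "sin z \<le> z - z ^ 3 / 6 + z ^ 5 / 120" by linarith
  hence "sin z / z \<le> (z - z ^ 3 / 6 + z ^ 5 / 120) / z"
    using assms by (intro divide_right_mono) auto
  also have "\<dots> = 1 - z\<^sup>2 / 6 + z\<^sup>2 * z\<^sup>2 / 120"
    using assms by (simp add: field_simps eval_nat_numeral)
  finally have 1: "sin z / z \<le> 1 - z\<^sup>2 / 6 + z\<^sup>2 * z\<^sup>2 / 120" .
  have "z\<^sup>2 \<le> 2\<^sup>2" using True assms by (intro power_mono) auto
  hence "z\<^sup>2 * z\<^sup>2 \<le> 4 * z\<^sup>2" by (intro mult_right_mono) auto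
  moreover have "min 1 (z\<^sup>2) \<le> z\<^sup>2" "0 \<le> z\<^sup>2" by simp_all
  ultimately show ?thesis using 1 by linarith
next
  case False
  have "sin z / z \<le> 1 / 2"
    using False sin_le_one[of z] assms by (simp add: pos_divide_le_eq del: sin_le_one)
  moreover have "min 1 (z\<^sup>2) \<le> 1" by simp
  ultimately show ?thesis by linarith
qed

text \<open>The integral is \<open>\<delta> * (1 - sin z / z)\<close> with
  \<open>z = \<delta> * \<bar>y\<bar>\<close>. Passing from z back to y costs
  \<open>\<delta>\<^sup>2\<close>, since \<open>\<delta> \<le> 1\<close>; together with the length
  of the interval this explains the cube.\<close>

lemma average_one_minus_cos_ge:
  assumes "0 < \<delta>" "\<delta> \<le> 1"
  shows "ennreal (\<delta> ^ 3 / 10 * min 1 (y\<^sup>2)) \<le> (\<integral>\<^sup>+x. ennreal (1 - cos (x * y)) \<partial>restrict_space lborel {0..\<delta>})"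
proof (cases "y = 0")
  case False
  define z where "z = \<delta> * \<bar>y\<bar>"
  have z: "z > 0" using False assms by (simp add: z_def)
  have "(\<integral>\<^sup>+x. ennreal (1 - cos (x * y)) \<partial>restrict_space lborel {0..\<delta>})
      = (\<integral>\<^sup>+x. ennreal (1 - cos (x * y)) * indicator {0..\<delta>} x \<partial>lborel)"
    by (subst nn_integral_restrict_space) auto
  also have "\<dots> = ennreal ((\<delta> - sin (\<delta> * y) / y) - (0 - sin (0 * y) / y))"
    using assms False
    by (intro nn_integral_FTC_Icc)
       (auto intro!: derivative_eq_intros borel_measurable_continuous_onI continuous_intros)
  also have "sin (\<delta> * y) / y = \<delta> * (sin z / z)"
    using False assms by (cases "y > 0") (auto simp: z_def)
  finally have "(\<integral>\<^sup>+x. ennreal (1 - cos (x * y)) \<partial>restrict_space lborel {0..\<delta>}) = ennreal (\<delta> * (1 - sin z / z))"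
    by (simp add: ring_distribs)
  moreover have "\<delta> ^ 3 / 10 * min 1 (y\<^sup>2) \<le> \<delta> * (1 - sin z / z)"
  proof -
    have "\<delta>\<^sup>2 * min 1 (y\<^sup>2) \<le> min 1 (z\<^sup>2)"
    proof -
      have "\<delta>\<^sup>2 \<le> 1" using assms by (simp add: power_le_one)
      moreover have "\<delta>\<^sup>2 * min 1 (y\<^sup>2) \<le> \<delta>\<^sup>2 * 1" "\<delta>\<^sup>2 * min 1 (y\<^sup>2) \<le> \<delta>\<^sup>2 * y\<^sup>2"
        by (intro mult_left_mono; simp)+
      ultimately show ?thesis by (simp add: z_def power_mult_distrib)
    qed
    hence "\<delta>\<^sup>2 * min 1 (y\<^sup>2) / 10 \<le> 1 - sin z / z"
      using one_minus_sinc_ge[OF z] by linarith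
    hence "\<delta> * (\<delta>\<^sup>2 * min 1 (y\<^sup>2) / 10) \<le> \<delta> * (1 - sin z / z)"
      using assms by (intro mult_left_mono) auto
    thus ?thesis by (simp add: eval_nat_numeral mult_ac)
  qed
  ultimately show ?thesis by (simp add: ennreal_leI)
qed simp

text \<open>Integrates the hypothesis \<open>le\<close> over all frequencies independently. One
  Fubini exchange per index replaces a product measure on the family s; the weight \<open>H\<close>
  is arbitrary so that, in the induction step, it can absorb the factor whose frequency is
  frozen.\<close>

lemma nn_integral_prod_average_le:
  fixes F :: "'k \<Rightarrow> 's \<Rightarrow> 't \<Rightarrow> ennreal" and M :: ennreal
  assumes "sigma_finite_measure S" "sigma_finite_measure \<nu>" "finite K"
    and F: "\<And>k. k \<in> K \<Longrightarrow> (\<lambda>(x, t). F k x t) \<in> borel_measurable (S \<Otimes>\<^sub>M \<nu>)"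
    and H: "H \<in> borel_measurable \<nu>"
    and le: "\<And>s. (\<And>k. k \<in> K \<Longrightarrow> s k \<in> space S) \<Longrightarrow> (\<integral>\<^sup>+t. H t * (\<Prod>k\<in>K. F k (s k) t) \<partial>\<nu>) \<le> M"
  shows "(\<integral>\<^sup>+t. H t * (\<Prod>k\<in>K. \<integral>\<^sup>+x. F k x t \<partial>S) \<partial>\<nu>) \<le> emeasure S (space S) ^ card K * M"
  using \<open>finite K\<close> F H le
proof (induction K arbitrary: H)
  case (insert k K)
  interpret S: sigma_finite_measure S by fact
  interpret N: sigma_finite_measure \<nu> by fact
  interpret SN: pair_sigma_finite S \<nu> ..
  note [measurable] = insert.prems(1,2)
  have F_meas [measurable]: "(\<lambda>(x, t). F j x t) \<in> borel_measurable (S \<Otimes>\<^sub>M \<nu>)" if "j \<in> insert k K" for j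
    using insert.prems(1)[OF that] .
  have Fk [measurable]: "(\<lambda>(x, t). F k x t) \<in> borel_measurable (S \<Otimes>\<^sub>M \<nu>)" by (rule F_meas) simp
  define G where "G t = (\<Prod>k\<in>K. \<integral>\<^sup>+x. F k x t \<partial>S)" for t
  have G [measurable]: "G \<in> borel_measurable \<nu>"
    unfolding G_def
  proof (rule borel_measurable_prod_ennreal)
    fix j assume "j \<in> K"
    hence "(\<lambda>(x, t). F j x t) \<in> borel_measurable (S \<Otimes>\<^sub>M \<nu>)" by (intro F_meas) auto
    hence "(\<lambda>(t, x). F j x t) \<in> borel_measurable (\<nu> \<Otimes>\<^sub>M S)"
      by (subst measurable_pair_swap_iff) (simp add: case_prod_beta)
    thus "(\<lambda>t. \<integral>\<^sup>+x. F j x t \<partial>S) \<in> borel_measurable \<nu>"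
      by (rule S.borel_measurable_nn_integral)
  qed
  have step: "(\<integral>\<^sup>+t. H t * F k x t * G t \<partial>\<nu>) \<le> emeasure S (space S) ^ card K * M" if x: "x \<in> space S" for x
    unfolding G_def
  proof (rule insert.IH)
    have "F k x \<in> borel_measurable \<nu>"
      using measurable_Pair2[OF Fk x] by simp
    thus "(\<lambda>t. H t * F k x t) \<in> borel_measurable \<nu>" by measurable
    fix s assume s: "\<And>j. j \<in> K \<Longrightarrow> s j \<in> space S"
    have "(\<integral>\<^sup>+t. H t * (\<Prod>j\<in>insert k K. F j ((s(k := x)) j) t) \<partial>\<nu>) \<le> M"
      by (rule insert.prems(3)) (use s x in auto)
    moreover have "(\<Prod>j\<in>K. F j ((s(k := x)) j) t) = (\<Prod>j\<in>K. F j (s j) t)" for t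
      using insert.hyps by (intro prod.cong) auto
    ultimately show "(\<integral>\<^sup>+t. H t * F k x t * (\<Prod>j\<in>K. F j (s j) t) \<partial>\<nu>) \<le> M"
      using insert.hyps by (simp add: mult.assoc)
  qed (use insert.prems in auto)
  have "(\<integral>\<^sup>+t. H t * (\<Prod>k\<in>insert k K. \<integral>\<^sup>+x. F k x t \<partial>S) \<partial>\<nu>)
      = (\<integral>\<^sup>+t. \<integral>\<^sup>+x. H t * F k x t * G t \<partial>S \<partial>\<nu>)"
  proof (rule nn_integral_cong)
    fix t assume "t \<in> space \<nu>"
    hence "(\<lambda>x. F k x t) \<in> borel_measurable S"
      using measurable_Pair1[OF Fk] by simp
    thus "H t * (\<Prod>k\<in>insert k K. \<integral>\<^sup>+x. F k x t \<partial>S) = (\<integral>\<^sup>+x. H t * F k x t * G t \<partial>S)"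
      using insert.hyps by (simp add: G_def nn_integral_cmult nn_integral_multc mult_ac)
  qed
  also have "\<dots> = (\<integral>\<^sup>+x. \<integral>\<^sup>+t. H t * F k x t * G t \<partial>\<nu> \<partial>S)"
    by (rule SN.Fubini') measurable
  also have "\<dots> \<le> (\<integral>\<^sup>+x. emeasure S (space S) ^ card K * M \<partial>S)"
    by (intro nn_integral_mono step)
  also have "\<dots> = emeasure S (space S) ^ card (insert k K) * M"
    using insert.hyps by (simp add: mult_ac)
  finally show ?case .
qed auto

section \<open>First-order expansion of the pairing\<close>

lemma bounded_linear_tgrad: "bounded_linear (tgrad p t)"
proof (induction p)
  case (Cons a p)
  obtain c s where a: "a = (c, s)" by force
  have "bounded_linear (\<lambda>v. complex_of_real (s \<bullet> v))"
    by (intro bounded_linear_compose[OF bounded_linear_of_real] bounded_linear_inner_right)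
  hence "bounded_linear (\<lambda>v. c * (\<i> * complex_of_real (s \<bullet> v)) * cis (s \<bullet> t) + tgrad p t v)"
    by (intro bounded_linear_add bounded_linear_mult_const bounded_linear_const_mult Cons)
  moreover have "tgrad (a # p) t = (\<lambda>v. c * (\<i> * complex_of_real (s \<bullet> v)) * cis (s \<bullet> t) + tgrad p t v)"
    by (simp add: a fun_eq_iff)
  ultimately show ?case by simp
next
  case Nil
  have "tgrad [] t = (\<lambda>v. 0)" by (simp add: fun_eq_iff)
  thus ?case by simp
qed

lemma
  fixes a :: "real^'d"
  assumes \<nu>: "\<nu> \<in> prob_on S" and "bounded S"
  shows integrable_minus_const: "integrable \<nu> (\<lambda>t. t - a)"
    and integrable_norm_sq: "integrable \<nu> (\<lambda>t. (norm (t - a))\<^sup>2)"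
proof -
  interpret prob_space \<nu> using \<nu> by (simp add: prob_on_def)
  have [measurable_cong]: "sets \<nu> = sets borel" and S: "AE t in \<nu>. t \<in> S"
    using \<nu> by (simp_all add: prob_on_def)
  obtain B where B: "\<And>t. t \<in> S \<Longrightarrow> norm t \<le> B"
    using \<open>bounded S\<close> by (auto simp: bounded_iff)
  have le: "AE t in \<nu>. norm (t - a) \<le> B + norm a"
    using S by eventually_elim (meson B add_right_mono norm_triangle_ineq4 order_trans)
  show "integrable \<nu> (\<lambda>t. t - a)"
    by (rule integrable_const_bound[OF le]) measurable
  have "AE t in \<nu>. norm ((norm (t - a))\<^sup>2) \<le> (B + norm a)\<^sup>2"
    using le by eventually_elim (auto intro!: power_mono)
  thus "integrable \<nu> (\<lambda>t. (norm (t - a))\<^sup>2)"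
    by (rule integrable_const_bound) measurable
qed

text \<open>The terms of \<open>N_size\<close> that have a sign, with the factor 1/2 dropped. This
  quantity is bounded first, and it is also the error scale of the first-order expansion.\<close>

fun dispersion :: "nat \<Rightarrow> (nat \<Rightarrow> real^'d) \<Rightarrow> 'd params \<Rightarrow> real" where
  "dispersion q \<theta> (\<eta>, \<beta>, \<rho>, \<tau>, \<nu>) =
     \<tau> 0 + (\<Sum>i=1..q. trace (\<rho> i) + \<tau> i * (\<integral>t. (norm (t - \<theta> i))\<^sup>2 \<partial>\<nu> i))"

text \<open>Each \<open>\<nu> i\<close> with i at least 1 is expanded at \<open>\<theta> i\<close>;
  \<open>\<nu> 0\<close> is not expanded but estimated by \<open>weight p\<close>. The three
  summands of the constant account for \<open>\<tau> 0\<close>, for the matrices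
  \<open>\<rho> i\<close> and for the Taylor remainders.\<close>

lemma pairing_first_order:
  fixes \<theta> :: "nat \<Rightarrow> real^'d"
  assumes P: "(\<eta>, \<beta>, \<rho>, \<tau>, \<nu>) \<in> param_set q A"
    and bdd: "\<And>i. i \<in> {1..q} \<Longrightarrow> bounded (A i)"
    and p: "freq_le r p"
  shows "norm (pairing q \<theta> (\<eta>, \<beta>, \<rho>, \<tau>, \<nu>) p
      - (\<Sum>i=1..q. of_real (\<eta> i + \<tau> i) * tval p (\<theta> i)
          + tgrad p (\<theta> i) (\<beta> i + \<tau> i *\<^sub>R (\<integral>t. (t - \<theta> i) \<partial>\<nu> i))))
    \<le> weight p * (1 + (real CARD('d))\<^sup>2 * r\<^sup>2 + r\<^sup>2) * dispersion q \<theta> (\<eta>, \<beta>, \<rho>, \<tau>, \<nu>)"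
proof -
  define C where "C = 1 + (real CARD('d))\<^sup>2 * r\<^sup>2 + r\<^sup>2"
  have C: "1 \<le> C" "(real CARD('d))\<^sup>2 * r\<^sup>2 \<le> C" "r\<^sup>2 \<le> C" by (simp_all add: C_def)
  have \<nu>: "\<nu> i \<in> prob_on (A i)" and \<tau>: "\<tau> i \<ge> 0" if "i \<in> {0..q}" for i
    using P that by (auto simp: param_set_def)
  have \<rho>: "\<rho> i \<in> psd_matrices" if "i \<in> {1..q}" for i
    using P that by (auto simp: param_set_def)
  define rem where "rem i = (\<integral>t. (tval p t - tval p (\<theta> i) - tgrad p (\<theta> i) (t - \<theta> i)) \<partial>\<nu> i)" for i
  have rem: "(\<integral>t. tval p t \<partial>\<nu> i) = tval p (\<theta> i) + tgrad p (\<theta> i) (\<integral>t. (t - \<theta> i) \<partial>\<nu> i) + rem i"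
    and rem_le: "norm (rem i) \<le> weight p * r\<^sup>2 * (\<integral>t. (norm (t - \<theta> i))\<^sup>2 \<partial>\<nu> i)"
    if i: "i \<in> {1..q}" for i
  proof -
    have \<nu>i: "\<nu> i \<in> prob_on (A i)" using i by (intro \<nu>) auto
    then interpret prob_space "\<nu> i" by (simp add: prob_on_def)
    note int = integrable_tval[OF \<nu>i, of p] integrable_minus_const[OF \<nu>i bdd[OF i], of "\<theta> i"]
      integrable_norm_sq[OF \<nu>i bdd[OF i], of "\<theta> i"]
    note lin = integrable_bounded_linear[OF bounded_linear_tgrad int(2)]
      integral_bounded_linear[OF bounded_linear_tgrad int(2)]
    show "(\<integral>t. tval p t \<partial>\<nu> i) = tval p (\<theta> i) + tgrad p (\<theta> i) (\<integral>t. (t - \<theta> i) \<partial>\<nu> i) + rem i"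
      unfolding rem_def using int lin by (simp add: prob_space)
    have "norm (rem i) \<le> (\<integral>t. norm (tval p t - tval p (\<theta> i) - tgrad p (\<theta> i) (t - \<theta> i)) \<partial>\<nu> i)"
      unfolding rem_def by (rule integral_norm_bound)
    also have "\<dots> \<le> (\<integral>t. weight p * (r * norm (t - \<theta> i))\<^sup>2 \<partial>\<nu> i)"
      using int lin norm_taylor_remainder_tval[OF p]
      by (intro integral_mono) (auto simp: power_mult_distrib)
    also have "\<dots> = weight p * r\<^sup>2 * (\<integral>t. (norm (t - \<theta> i))\<^sup>2 \<partial>\<nu> i)"
      by (simp add: power_mult_distrib mult.assoc)
    finally show "norm (rem i) \<le> weight p * r\<^sup>2 * (\<integral>t. (norm (t - \<theta> i))\<^sup>2 \<partial>\<nu> i)" .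
  qed
  have grad: "tgrad p t (v + c *\<^sub>R w) = tgrad p t v + of_real c * tgrad p t w" for t v c w
    using bounded_linear_tgrad[of p t]
    by (simp add: linear_simps scaleR_conv_of_real[where 'a = complex])
  have "pairing q \<theta> (\<eta>, \<beta>, \<rho>, \<tau>, \<nu>) p
      - (\<Sum>i=1..q. of_real (\<eta> i + \<tau> i) * tval p (\<theta> i)
          + tgrad p (\<theta> i) (\<beta> i + \<tau> i *\<^sub>R (\<integral>t. (t - \<theta> i) \<partial>\<nu> i)))
    = of_real (\<tau> 0) * (\<integral>t. tval p t \<partial>\<nu> 0) + (\<Sum>i=1..q. htr (\<rho> i) p (\<theta> i) + of_real (\<tau> i) * rem i)"
  proof -
    have "(a + sum f I) - sum g I = a + (\<Sum>i\<in>I. f i - g i)" for a :: complex and f g and I :: "nat set"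
      by (simp add: sum_subtractf)
    thus ?thesis
      unfolding pairing.simps grad
      by (simp only:) (intro arg_cong2[where f = "(+)"] sum.cong refl, simp add: rem algebra_simps)
  qed
  also have "norm \<dots> \<le> weight p * C * \<tau> 0
      + (\<Sum>i=1..q. weight p * C * (trace (\<rho> i) + \<tau> i * (\<integral>t. (norm (t - \<theta> i))\<^sup>2 \<partial>\<nu> i)))"
  proof (intro norm_triangle_mono sum_norm_le)
    interpret prob_space "\<nu> 0" using \<nu>[of 0] by (simp add: prob_on_def)
    have "norm (\<integral>t. tval p t \<partial>\<nu> 0) \<le> (\<integral>t. weight p \<partial>\<nu> 0)"
      by (rule order_trans[OF integral_norm_bound], rule integral_mono)
         (use integrable_tval[OF \<nu>[of 0]] in \<open>auto simp: norm_tval_le\<close>)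
    also have "\<dots> \<le> weight p * C"
      using C(1) weight_nonneg[of p] by (simp add: prob_space mult_le_cancel_left1)
    finally have "\<tau> 0 * norm (\<integral>t. tval p t \<partial>\<nu> 0) \<le> \<tau> 0 * (weight p * C)"
      using \<tau>[of 0] by (intro mult_left_mono) auto
    thus "norm (of_real (\<tau> 0) * (\<integral>t. tval p t \<partial>\<nu> 0)) \<le> weight p * C * \<tau> 0"
      using \<tau>[of 0] by (simp add: norm_mult mult_ac)
  next
    fix i assume i: "i \<in> {1..q}"
    define m where "m = (\<integral>t. (norm (t - \<theta> i))\<^sup>2 \<partial>\<nu> i)"
    have m: "0 \<le> m" unfolding m_def by (intro integral_nonneg_AE) auto
    have "norm (htr (\<rho> i) p (\<theta> i)) \<le> weight p * ((real CARD('d))\<^sup>2 * r\<^sup>2 * trace (\<rho> i))"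
      by (rule norm_htr_le[OF \<rho>[OF i] p])
    also have "\<dots> \<le> weight p * (C * trace (\<rho> i))"
      by (intro mult_left_mono mult_right_mono C weight_nonneg trace_psd_nonneg \<rho>[OF i])
    finally have 1: "norm (htr (\<rho> i) p (\<theta> i)) \<le> weight p * (C * trace (\<rho> i))" .
    have "\<tau> i * norm (rem i) \<le> \<tau> i * (weight p * r\<^sup>2 * m)"
      using \<tau>[of i] i rem_le[OF i] by (intro mult_left_mono) (auto simp: m_def)
    also have "\<dots> \<le> \<tau> i * (weight p * C * m)"
      using \<tau>[of i] i by (intro mult_left_mono mult_right_mono C weight_nonneg m) auto
    finally have "norm (of_real (\<tau> i) * rem i) \<le> \<tau> i * (weight p * C * m)"
      using \<tau>[of i] i by (simp add: norm_mult)
    with 1 have "norm (htr (\<rho> i) p (\<theta> i) + of_real (\<tau> i) * rem i)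
        \<le> weight p * (C * trace (\<rho> i)) + \<tau> i * (weight p * C * m)"
      by (rule norm_triangle_mono)
    thus "norm (htr (\<rho> i) p (\<theta> i) + of_real (\<tau> i) * rem i)
        \<le> weight p * C * (trace (\<rho> i) + \<tau> i * (\<integral>t. (norm (t - \<theta> i))\<^sup>2 \<partial>\<nu> i))"
      by (simp add: m_def[symmetric] algebra_simps)
  qed
  also have "\<dots> = weight p * C * dispersion q \<theta> (\<eta>, \<beta>, \<rho>, \<tau>, \<nu>)"
    by (simp add: ring_distribs sum_distrib_left)
  finally show ?thesis by (simp only: C_def)
qed

section \<open>Bounds for the parameters in terms of the pairing\<close>

locale separated_neighbourhoods =
  fixes q :: nat and \<theta> :: "nat \<Rightarrow> real^'d" and A :: "nat \<Rightarrow> (real^'d) set" and \<epsilon> :: real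
  assumes bounded_A: "\<And>i. i \<in> {1..q} \<Longrightarrow> bounded (A i)"
    and interior_A: "\<And>i. i \<in> {1..q} \<Longrightarrow> \<theta> i \<in> interior (A i)"
    and disjoint_A: "disjoint_family_on A {1..q}"
    and A_0: "A 0 = - (\<Union>i\<in>{1..q}. A i)"
    and eps_pos: "0 < \<epsilon>"
begin

text \<open>The frequency allowance of one factor: q factors and one additional sine stay within
  \<epsilon>. The cap at 1 serves the averaging estimate and keeps phases below pi.\<close>

definition \<delta> :: real where "\<delta> = min 1 (\<epsilon> / (real q + 1))"

lemma delta: "0 < \<delta>" "\<delta> \<le> 1" "real q * \<delta> \<le> \<epsilon>" "real q * \<delta> + \<delta> \<le> \<epsilon>"
proof -
  show "0 < \<delta>" "\<delta> \<le> 1" using eps_pos by (auto simp: \<delta>_def)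
  have "(real q + 1) * \<delta> \<le> (real q + 1) * (\<epsilon> / (real q + 1))"
    by (intro mult_left_mono) (auto simp: \<delta>_def)
  also have "\<dots> = \<epsilon>" by simp
  finally show "real q * \<delta> + \<delta> \<le> \<epsilon>" by (simp add: distrib_right)
  thus "real q * \<delta> \<le> \<epsilon>" using \<open>0 < \<delta>\<close> by simp
qed

lemma radius:
  obtains r where "0 < r" "r \<le> 1" "\<And>i. i \<in> {1..q} \<Longrightarrow> ball (\<theta> i) r \<subseteq> A i"
proof -
  have "\<forall>i\<in>{1..q}. \<exists>e>0. ball (\<theta> i) e \<subseteq> A i"
    using interior_A by (simp add: mem_interior)
  then obtain e where e: "\<And>i. i \<in> {1..q} \<Longrightarrow> 0 < e i \<and> ball (\<theta> i) (e i) \<subseteq> A i"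
    by metis
  define r where "r = Min (insert 1 (e ` {1..q}))"
  have "0 < r" unfolding r_def using e by (subst Min_gr_iff) auto
  moreover have "r \<le> 1" "\<And>i. i \<in> {1..q} \<Longrightarrow> r \<le> e i"
    unfolding r_def by (rule Min_le; simp)+
  ultimately show ?thesis
    using that e by (meson subset_ball subset_trans)
qed

lemma theta_distinct:
  assumes "i \<in> {1..q}" "k \<in> {1..q}" "i \<noteq> k"
  shows "\<theta> i \<noteq> \<theta> k"
proof -
  have "A i \<inter> A k = {}" using disjoint_A assms by (simp add: disjoint_family_on_def)
  moreover have "\<theta> i \<in> A i" "\<theta> k \<in> A k" using interior_A assms(1,2) interior_subset by blast+
  ultimately show ?thesis by auto
qed

text \<open>Each frequency points along \<open>\<theta> i - \<theta> k\<close>, so the phase at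
  \<open>\<theta> i\<close> is positive, and it is short enough for the phase to stay below pi,
  where the cosine is less than 1.\<close>

lemma separating_frequencies:
  assumes i: "i \<in> {1..q}"
  obtains s where "\<And>k. norm (s k) \<le> \<delta>" "0 < (\<Prod>k\<in>{1..q} - {i}. 1 - cos (s k \<bullet> (\<theta> i - \<theta> k)))"
proof -
  have "\<exists>s. norm s \<le> \<delta> \<and> (k \<in> {1..q} - {i} \<longrightarrow> cos (s \<bullet> (\<theta> i - \<theta> k)) < 1)" for k
  proof -
    define y where "y = \<theta> i - \<theta> k"
    \<comment> \<open>This denominator exceeds both \<open>norm y\<close> and its square and never
      vanishes: the first keeps the frequency within \<delta>, the second keeps the phase
      \<open>\<sigma> * (norm y)\<^sup>2\<close> within \<delta>.\<close>
    define \<sigma> where "\<sigma> = \<delta> / (1 + (norm y)\<^sup>2)"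
    have \<sigma>: "0 < \<sigma>" using delta by (simp add: \<sigma>_def add_pos_nonneg)
    have le: "norm y \<le> 1 + (norm y)\<^sup>2"
    proof -
      have "2 * norm y \<le> (norm y)\<^sup>2 + 1"
        using zero_le_power2[of "norm y - 1"] by (simp add: power2_diff)
      thus ?thesis using norm_ge_zero[of y] by linarith
    qed
    have "norm (\<sigma> *\<^sub>R y) \<le> \<delta>"
      using le \<sigma> delta by (simp add: \<sigma>_def pos_divide_le_eq add_pos_nonneg mult_left_mono)
    moreover have "cos ((\<sigma> *\<^sub>R y) \<bullet> y) < 1" if "k \<in> {1..q} - {i}"
    proof -
      have "y \<noteq> 0" using theta_distinct[of i k] that i by (auto simp: y_def)
      hence "0 < \<sigma> * (norm y)\<^sup>2" using \<sigma> by simp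
      moreover have "\<sigma> * (norm y)\<^sup>2 \<le> \<delta> * 1"
        using delta by (simp add: \<sigma>_def pos_divide_le_eq add_pos_nonneg)
      hence "\<sigma> * (norm y)\<^sup>2 \<le> pi" using delta(2) pi_gt3 by simp
      ultimately have "cos (\<sigma> * (norm y)\<^sup>2) < cos 0"
        by (intro cos_monotone_0_pi) auto
      thus ?thesis by (simp add: power2_norm_eq_inner)
    qed
    ultimately show ?thesis unfolding y_def by blast
  qed
  then obtain s where "\<And>k. norm (s k) \<le> \<delta> \<and> (k \<in> {1..q} - {i} \<longrightarrow> cos (s k \<bullet> (\<theta> i - \<theta> k)) < 1)"
    by metis
  thus ?thesis by (intro that[of s] prod_pos) auto
qed

text \<open>The frequency \<open>s i\<close> does not occur in the product over the other indices,
  so it can run through the multiples \<open>\<delta> *\<^sub>R axis j 1\<close> while that product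
  stays fixed; each choice reads off one diagonal entry.\<close>

lemma trace_bound:
  assumes i: "i \<in> {1..q}"
  obtains C where "\<And>\<eta> \<beta> \<rho> \<tau> \<nu> M. (\<eta>, \<beta>, \<rho>, \<tau>, \<nu>) \<in> param_set q A \<Longrightarrow>
    pairing_bounded \<epsilon> q \<theta> (\<eta>, \<beta>, \<rho>, \<tau>, \<nu>) M \<Longrightarrow> trace (\<rho> i) \<le> C * M"
proof -
  obtain s where s: "\<And>k. norm (s k) \<le> \<delta>"
    and pos: "0 < (\<Prod>k\<in>{1..q} - {i}. 1 - cos (s k \<bullet> (\<theta> i - \<theta> k)))" (is "0 < ?\<kappa>")
    using separating_frequencies[OF i] by blast
  define C where "C = real CARD('d) * (2 ^ q / (?\<kappa> * \<delta>\<^sup>2))"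
  have "trace (\<rho> i) \<le> C * M"
    if P: "(\<eta>, \<beta>, \<rho>, \<tau>, \<nu>) \<in> param_set q A" and bdd: "pairing_bounded \<epsilon> q \<theta> (\<eta>, \<beta>, \<rho>, \<tau>, \<nu>) M"
    for \<eta> \<beta> \<rho> \<tau> \<nu> M
  proof -
    have "\<rho> i $ j $ j \<le> 2 ^ q * M / (?\<kappa> * \<delta>\<^sup>2)" for j
    proof -
      define s' where "s' = s(i := \<delta> *\<^sub>R axis j 1)"
      have s': "norm (s' k) \<le> \<delta>" for k using s delta by (simp add: s'_def)
      have "(\<Prod>k\<in>{1..q} - {i}. 1 - cos (s' k \<bullet> (\<theta> i - \<theta> k))) = ?\<kappa>"
        by (intro prod.cong) (auto simp: s'_def)
      moreover have "s' i \<bullet> (\<rho> i *v s' i) = \<delta>\<^sup>2 * \<rho> i $ j $ j"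
        by (simp add: s'_def matrix_vector_mult_scaleR matrix_vector_mult_basis column_def
            inner_axis' power2_eq_square)
      ultimately have "?\<kappa> * (\<delta>\<^sup>2 * \<rho> i $ j $ j) \<le> 2 ^ q * M"
        using bump_bounds_psd[where s = s', OF P bdd s' delta(3) i] by simp
      thus ?thesis using pos delta by (simp add: pos_le_divide_eq mult_ac)
    qed
    hence "trace (\<rho> i) \<le> (\<Sum>j\<in>(UNIV::'d set). 2 ^ q * M / (?\<kappa> * \<delta>\<^sup>2))"
      unfolding trace_def by (intro sum_mono)
    thus ?thesis by (simp add: C_def)
  qed
  thus ?thesis using that by blast
qed

text \<open>For fixed frequencies \<open>bump\<close> is almost periodic, hence not bounded below far from the
  \<open>\<theta> k\<close>. Averaging over the frequencies \<open>x k *\<^sub>R axis (J k) 1\<close> with \<open>0 \<le> x k \<le> \<delta>\<close> cures this.\<close>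

lemma averaged_bump_bound:
  assumes P: "(\<eta>, \<beta>, \<rho>, \<tau>, \<nu>) \<in> param_set q A" and bdd: "pairing_bounded \<epsilon> q \<theta> (\<eta>, \<beta>, \<rho>, \<tau>, \<nu>) M"
    and i: "i \<in> {0..q}"
  shows "(\<integral>\<^sup>+t. ennreal (\<tau> i * (\<Prod>k=1..q. \<delta> ^ 3 / 10 * min 1 ((norm (t - \<theta> k))\<^sup>2))) \<partial>\<nu> i)
    \<le> ennreal ((2 * \<delta> * real CARD('d)) ^ q * M)"
proof -
  have \<nu>: "\<nu> i \<in> prob_on (A i)" and \<tau>: "0 \<le> \<tau> i" using P i by (auto simp: param_set_def)
  interpret prob_space "\<nu> i" using \<nu> by (simp add: prob_on_def)
  have sets [measurable_cong]: "sets (\<nu> i) = sets borel" using \<nu> by (simp add: prob_on_def)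
  have M: "0 \<le> M" using pairing_bounded_nonneg[OF bdd] eps_pos by simp
  define S where "S = restrict_space lborel {0..\<delta>}"
  have S_mass: "emeasure S (space S) = ennreal \<delta>"
    using delta by (simp add: S_def space_restrict_space emeasure_restrict_space)
  have S_fin: "sigma_finite_measure S"
    by (intro finite_measure.sigma_finite_measure finite_measureI) (simp add: S_mass)
  interpret S: sigma_finite_measure S by fact
  define G where "G k j t = (\<integral>\<^sup>+x. ennreal (1 - cos (x * (t - \<theta> k) $ j)) \<partial>S)" for k j t
  have cont: "continuous_on UNIV (\<lambda>(x::real, t). 1 - cos (x * (t - \<theta> k) $ j))" for k j
    unfolding case_prod_beta by (intro continuous_intros)
  have F_meas: "(\<lambda>(x, t). ennreal (1 - cos (x * (t - \<theta> k) $ j))) \<in> borel_measurable (S \<Otimes>\<^sub>M \<nu> i)" for k j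
  proof -
    have "(\<lambda>(x::real, t). 1 - cos (x * (t - \<theta> k) $ j)) \<in> borel_measurable (borel \<Otimes>\<^sub>M borel)"
      using borel_measurable_continuous_onI[OF cont] by (simp add: borel_prod)
    moreover have "(\<lambda>z. (fst z, snd z)) \<in> S \<Otimes>\<^sub>M \<nu> i \<rightarrow>\<^sub>M borel \<Otimes>\<^sub>M borel"
    proof (rule measurable_Pair)
      have "(\<lambda>x. x) \<in> S \<rightarrow>\<^sub>M borel" unfolding S_def by (rule measurable_restrict_space1) simp
      thus "fst \<in> S \<Otimes>\<^sub>M \<nu> i \<rightarrow>\<^sub>M borel" by (rule measurable_compose[OF measurable_fst])
      show "snd \<in> S \<Otimes>\<^sub>M \<nu> i \<rightarrow>\<^sub>M borel"
        by (rule measurable_compose[OF measurable_snd measurable_ident_sets[OF sets]])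
    qed
    ultimately have "(\<lambda>(x::real, t). 1 - cos (x * (t - \<theta> k) $ j)) \<in> borel_measurable (S \<Otimes>\<^sub>M \<nu> i)"
      using measurable_compose[of "\<lambda>z. (fst z, snd z)"] by simp
    thus ?thesis by (simp add: case_prod_beta)
  qed
  have G_meas [measurable]: "G k j \<in> borel_measurable (\<nu> i)" for k j
  proof -
    have "(\<lambda>(t, x). ennreal (1 - cos (x * (t - \<theta> k) $ j))) \<in> borel_measurable (\<nu> i \<Otimes>\<^sub>M S)"
      using F_meas[of k j] by (subst measurable_pair_swap_iff) (simp add: case_prod_beta)
    thus ?thesis unfolding G_def[abs_def] by (rule S.borel_measurable_nn_integral)
  qed
  \<comment> \<open>With the axes \<open>J k\<close> fixed, \<open>bump_bounds_measure\<close> holds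
    for all lengths \<open>x k\<close> between 0 and \<delta> and is integrated over them; each of
    the q integrations contributes the mass \<delta> of \<open>S\<close>.\<close>
  have one: "(\<integral>\<^sup>+t. ennreal (\<tau> i) * (\<Prod>k=1..q. G k (J k) t) \<partial>\<nu> i) \<le> ennreal \<delta> ^ q * ennreal (2 ^ q * M)" for J
  proof -
    have "(\<integral>\<^sup>+t. ennreal (\<tau> i) * (\<Prod>k=1..q. G k (J k) t) \<partial>\<nu> i)
        \<le> emeasure S (space S) ^ card {1..q} * ennreal (2 ^ q * M)"
      unfolding G_def
    proof (rule nn_integral_prod_average_le)
      fix x assume x: "\<And>k. k \<in> {1..q} \<Longrightarrow> x k \<in> space S"
      define s where "s k = x k *\<^sub>R (axis (J k) 1 :: real^'d)" for k
      have s: "norm (s k) \<le> \<delta>" if "k \<in> {1..q}" for k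
        using x[OF that] by (simp add: s_def S_def space_restrict_space)
      have "\<tau> i * (\<integral>t. (\<Prod>k=1..q. 1 - cos (s k \<bullet> (t - \<theta> k))) \<partial>\<nu> i) \<le> 2 ^ q * M"
        by (rule bump_bounds_measure[OF P bdd s delta(3) i])
      moreover have "(\<integral>\<^sup>+t. ennreal (\<tau> i) * (\<Prod>k=1..q. ennreal (1 - cos (x k * (t - \<theta> k) $ J k))) \<partial>\<nu> i)
         = ennreal (\<tau> i * (\<integral>t. (\<Prod>k=1..q. 1 - cos (s k \<bullet> (t - \<theta> k))) \<partial>\<nu> i))"
      proof -
        have "continuous_on UNIV (\<lambda>t. \<Prod>k=1..q. 1 - cos (s k \<bullet> (t - \<theta> k)))"
          by (intro continuous_intros)
        hence [measurable]: "(\<lambda>t. \<Prod>k=1..q. 1 - cos (s k \<bullet> (t - \<theta> k))) \<in> borel_measurable borel"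
          by (rule borel_measurable_continuous_onI)
        have "(\<Prod>k=1..q. 1 - cos (s k \<bullet> (t - \<theta> k))) \<le> 2 ^ q" for t
        proof -
          have "(\<Prod>k=1..q. 1 - cos (s k \<bullet> (t - \<theta> k))) \<le> (\<Prod>k=1..q. 2)"
            by (intro prod_mono) (auto intro: order_trans[of _ "1 + 1"] simp: minus_le_iff)
          thus ?thesis by simp
        qed
        hence int: "integrable (\<nu> i) (\<lambda>t. \<Prod>k=1..q. 1 - cos (s k \<bullet> (t - \<theta> k)))"
          by (intro integrable_const_bound[of _ "2 ^ q"])
             (auto simp: abs_of_nonneg[OF one_minus_cos_prod_nonneg])
        have "(\<integral>\<^sup>+t. ennreal (\<tau> i) * (\<Prod>k=1..q. ennreal (1 - cos (x k * (t - \<theta> k) $ J k))) \<partial>\<nu> i)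
           = (\<integral>\<^sup>+t. ennreal (\<tau> i * (\<Prod>k=1..q. 1 - cos (s k \<bullet> (t - \<theta> k)))) \<partial>\<nu> i)"
          by (simp add: prod_ennreal ennreal_mult' \<tau> s_def inner_axis' one_minus_cos_prod_nonneg)
        also have "\<dots> = ennreal (\<integral>t. \<tau> i * (\<Prod>k=1..q. 1 - cos (s k \<bullet> (t - \<theta> k))) \<partial>\<nu> i)"
          using int by (intro nn_integral_eq_integral) (auto intro!: AE_I2 mult_nonneg_nonneg \<tau> one_minus_cos_prod_nonneg)
        finally show ?thesis by simp
      qed
      ultimately show "(\<integral>\<^sup>+t. ennreal (\<tau> i) * (\<Prod>k=1..q. ennreal (1 - cos (x k * (t - \<theta> k) $ J k))) \<partial>\<nu> i)
          \<le> ennreal (2 ^ q * M)"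
        by (simp add: ennreal_leI)
    qed (use F_meas in \<open>auto simp: S_fin sigma_finite_measure_axioms\<close>)
    thus ?thesis by (simp add: S_mass)
  qed
  \<comment> \<open>An average along one axis sees a single coordinate of
    \<open>t - \<theta> k\<close>; summing over the axes recovers the whole norm.\<close>
  have ge: "ennreal (\<delta> ^ 3 / 10 * min 1 ((norm (t - \<theta> k))\<^sup>2)) \<le> (\<Sum>j\<in>UNIV. G k j t)" for k t
  proof -
    define y where "y = t - \<theta> k"
    have "min 1 ((norm y)\<^sup>2) \<le> (\<Sum>j\<in>UNIV. min 1 ((y $ j)\<^sup>2))"
    proof (cases "\<exists>j. (y $ j)\<^sup>2 \<ge> 1")
      case True
      then obtain j where "(y $ j)\<^sup>2 \<ge> 1" by blast
      hence "1 \<le> min 1 ((y $ j)\<^sup>2)" by simp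
      also have "\<dots> \<le> (\<Sum>j\<in>UNIV. min 1 ((y $ j)\<^sup>2))" by (rule member_le_sum) auto
      finally show ?thesis by simp
    next
      case False
      hence "(\<Sum>j\<in>UNIV. min 1 ((y $ j)\<^sup>2)) = (\<Sum>j\<in>UNIV. (y $ j)\<^sup>2)"
        by (intro sum.cong) (auto simp: min_def)
      also have "\<dots> = (norm y)\<^sup>2"
        by (simp add: norm_vec_def L2_set_def sum_nonneg)
      finally show ?thesis by simp
    qed
    hence "\<delta> ^ 3 / 10 * min 1 ((norm y)\<^sup>2) \<le> \<delta> ^ 3 / 10 * (\<Sum>j\<in>UNIV. min 1 ((y $ j)\<^sup>2))"
      using delta by (intro mult_left_mono) auto
    hence "ennreal (\<delta> ^ 3 / 10 * min 1 ((norm y)\<^sup>2)) \<le> (\<Sum>j\<in>UNIV. ennreal (\<delta> ^ 3 / 10 * min 1 ((y $ j)\<^sup>2)))"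
      using delta by (subst sum_ennreal) (auto simp: sum_distrib_left intro!: ennreal_leI)
    also have "\<dots> \<le> (\<Sum>j\<in>UNIV. G k j t)"
      unfolding G_def S_def y_def by (intro sum_mono average_one_minus_cos_ge delta)
    finally show ?thesis by (simp add: y_def)
  qed
  have "(\<integral>\<^sup>+t. ennreal (\<tau> i * (\<Prod>k=1..q. \<delta> ^ 3 / 10 * min 1 ((norm (t - \<theta> k))\<^sup>2))) \<partial>\<nu> i)
      = (\<integral>\<^sup>+t. ennreal (\<tau> i) * (\<Prod>k=1..q. ennreal (\<delta> ^ 3 / 10 * min 1 ((norm (t - \<theta> k))\<^sup>2))) \<partial>\<nu> i)"
    using delta \<tau> by (subst prod_ennreal) (auto simp: ennreal_mult')
  also have "\<dots> \<le> (\<integral>\<^sup>+t. ennreal (\<tau> i) * (\<Prod>k=1..q. \<Sum>j\<in>UNIV. G k j t) \<partial>\<nu> i)"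
    by (intro nn_integral_mono mult_left_mono prod_mono_ennreal ge) auto
  \<comment> \<open>Distributing the product over the sums gives one term for each choice
    \<open>J\<close> of axes, \<open>CARD('d) ^ q\<close> in all, and \<open>one\<close> covers each
    of them.\<close>
  also have "\<dots> = (\<integral>\<^sup>+t. (\<Sum>J\<in>PiE {1..q} (\<lambda>_. UNIV). ennreal (\<tau> i) * (\<Prod>k=1..q. G k (J k) t)) \<partial>\<nu> i)"
    by (simp add: prod_sum_PiE sum_distrib_left)
  also have "\<dots> = (\<Sum>J\<in>PiE {1..q} (\<lambda>_. UNIV). \<integral>\<^sup>+t. ennreal (\<tau> i) * (\<Prod>k=1..q. G k (J k) t) \<partial>\<nu> i)"
    by (rule nn_integral_sum) measurable
  also have "\<dots> \<le> (\<Sum>J\<in>PiE {1..q} (\<lambda>_. UNIV :: 'd set). ennreal \<delta> ^ q * ennreal (2 ^ q * M))"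
    by (intro sum_mono one)
  also have "\<dots> = ennreal ((2 * \<delta> * real CARD('d)) ^ q * M)"
    using delta M
    by (simp add: card_PiE power_mult_distrib ennreal_power ennreal_of_nat_eq_real_of_nat
        mult_ac flip: ennreal_mult)
  finally show ?thesis .
qed

text \<open>The averaged bump is bounded below region by region. On \<open>A 0\<close> the point t
  has distance at least r from all centres. On \<open>A i\<close> this holds for the other centres
  by disjointness, and the remaining factor dominates the squared distance to
  \<open>\<theta> i\<close> because \<open>A i\<close> is bounded.\<close>

lemma dispersion_bound_parts:
  obtains C0 C where
    "\<And>\<eta> \<beta> \<rho> \<tau> \<nu> M. (\<eta>, \<beta>, \<rho>, \<tau>, \<nu>) \<in> param_set q A \<Longrightarrow>
      pairing_bounded \<epsilon> q \<theta> (\<eta>, \<beta>, \<rho>, \<tau>, \<nu>) M \<Longrightarrow> \<tau> 0 \<le> C0 * M"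
    "\<And>\<eta> \<beta> \<rho> \<tau> \<nu> M i. (\<eta>, \<beta>, \<rho>, \<tau>, \<nu>) \<in> param_set q A \<Longrightarrow>
      pairing_bounded \<epsilon> q \<theta> (\<eta>, \<beta>, \<rho>, \<tau>, \<nu>) M \<Longrightarrow> i \<in> {1..q} \<Longrightarrow>
      \<tau> i * (\<integral>t. (norm (t - \<theta> i))\<^sup>2 \<partial>\<nu> i) \<le> C * M"
proof -
  obtain r where r: "0 < r" "r \<le> 1" and ball: "\<And>i. i \<in> {1..q} \<Longrightarrow> ball (\<theta> i) r \<subseteq> A i"
    using radius by blast
  have "\<exists>b. \<forall>t\<in>A i. norm (t - \<theta> i) \<le> b" if "i \<in> {1..q}" for i
    using bounded_A[OF that] by (metis bounded_any_center dist_commute dist_norm)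
  then obtain b where b: "\<And>i t. i \<in> {1..q} \<Longrightarrow> t \<in> A i \<Longrightarrow> norm (t - \<theta> i) \<le> b i"
    by metis
  \<comment> \<open>One radius for all \<open>A i\<close>. Since it is also at least 1, the squared
    distance divided by \<open>B\<^sup>2\<close> lies below both entries of the minimum.\<close>
  define B where "B = 1 + (\<Sum>i=1..q. \<bar>b i\<bar>)"
  have B: "1 \<le> B" by (simp add: B_def sum_nonneg)
  have B': "norm (t - \<theta> i) \<le> B" if i: "i \<in> {1..q}" and t: "t \<in> A i" for i t
  proof -
    have "\<bar>b i\<bar> \<le> (\<Sum>i=1..q. \<bar>b i\<bar>)" using i by (intro member_le_sum) auto
    thus ?thesis using b[OF i t] by (simp add: B_def)
  qed
  define c where "c = \<delta> ^ 3 / 10"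
  have c: "0 < c" using delta by (simp add: c_def)
  define m where "m t = (\<Prod>k=1..q. c * min 1 ((norm (t - \<theta> k))\<^sup>2))" for t
  define K where "K = (2 * \<delta> * real CARD('d)) ^ q"
  have K: "0 \<le> K" using delta by (simp add: K_def)
  \<comment> \<open>The power \<open>q - 1\<close> comes from the centres other than
    \<open>\<theta> i\<close>, the last factor from \<open>\<theta> i\<close> itself.\<close>
  define e where "e = (c * r\<^sup>2) ^ (q - 1) * (c / B\<^sup>2)"
  have e: "0 < e" using c r B by (simp add: e_def)
  have far: "r\<^sup>2 \<le> min 1 ((norm (t - \<theta> k))\<^sup>2)" if "k \<in> {1..q}" "t \<notin> A k" for k t
  proof -
    have "t \<notin> ball (\<theta> k) r" using ball that by blast
    hence "r \<le> norm (t - \<theta> k)" by (simp add: dist_norm norm_minus_commute)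
    thus ?thesis using r by (simp add: power_mono power_le_one)
  qed
  have m0: "(c * r\<^sup>2) ^ q \<le> m t" if "t \<in> A 0" for t
  proof -
    have "(\<Prod>k=1..q. c * r\<^sup>2) \<le> m t"
      unfolding m_def using that c A_0 by (intro prod_mono conjI mult_left_mono far) auto
    thus ?thesis by simp
  qed
  have mi: "e * (norm (t - \<theta> i))\<^sup>2 \<le> m t" if i: "i \<in> {1..q}" and t: "t \<in> A i" for i t
  proof -
    have "(\<Prod>k\<in>{1..q} - {i}. c * r\<^sup>2) \<le> (\<Prod>k\<in>{1..q} - {i}. c * min 1 ((norm (t - \<theta> k))\<^sup>2))"
    proof (intro prod_mono conjI mult_left_mono far)
      fix k assume "k \<in> {1..q} - {i}"
      hence "A i \<inter> A k = {}" using disjoint_A i unfolding disjoint_family_on_def by auto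
      thus "t \<notin> A k" using t by blast
    qed (use c in auto)
    hence 1: "(c * r\<^sup>2) ^ (q - 1) \<le> (\<Prod>k\<in>{1..q} - {i}. c * min 1 ((norm (t - \<theta> k))\<^sup>2))"
      using i by (simp add: card_Diff_singleton)
    have "(norm (t - \<theta> i))\<^sup>2 / B\<^sup>2 \<le> min 1 ((norm (t - \<theta> i))\<^sup>2)"
    proof -
      have "(norm (t - \<theta> i))\<^sup>2 \<le> B\<^sup>2" using B'[OF i t] by (intro power_mono) auto
      moreover have "1 * (norm (t - \<theta> i))\<^sup>2 \<le> B\<^sup>2 * (norm (t - \<theta> i))\<^sup>2"
        using B by (intro mult_right_mono) auto
      ultimately show ?thesis using B by (simp add: divide_le_eq mult.commute)
    qed
    hence 2: "c * ((norm (t - \<theta> i))\<^sup>2 / B\<^sup>2) \<le> c * min 1 ((norm (t - \<theta> i))\<^sup>2)"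
      using c by (intro mult_left_mono) auto
    have "e * (norm (t - \<theta> i))\<^sup>2 = (c * r\<^sup>2) ^ (q - 1) * (c * ((norm (t - \<theta> i))\<^sup>2 / B\<^sup>2))"
      by (simp add: e_def)
    also have "\<dots> \<le> (\<Prod>k\<in>{1..q} - {i}. c * min 1 ((norm (t - \<theta> k))\<^sup>2)) * (c * min 1 ((norm (t - \<theta> i))\<^sup>2))"
      using c by (intro mult_mono 1 2) (auto intro!: prod_nonneg)
    also have "\<dots> = m t" using i by (simp add: m_def prod.remove[of _ i] mult.commute)
    finally show ?thesis .
  qed
  have t0: "\<tau> 0 \<le> K / (c * r\<^sup>2) ^ q * M"
    if P: "(\<eta>, \<beta>, \<rho>, \<tau>, \<nu>) \<in> param_set q A" and bdd: "pairing_bounded \<epsilon> q \<theta> (\<eta>, \<beta>, \<rho>, \<tau>, \<nu>) M"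
    for \<eta> \<beta> \<rho> \<tau> \<nu> M
  proof -
    have \<nu>: "\<nu> 0 \<in> prob_on (A 0)" and \<tau>: "0 \<le> \<tau> 0" using P by (auto simp: param_set_def)
    interpret prob_space "\<nu> 0" using \<nu> by (simp add: prob_on_def)
    have AE: "AE t in \<nu> 0. t \<in> A 0" using \<nu> by (simp add: prob_on_def)
    have M: "0 \<le> M" using pairing_bounded_nonneg[OF bdd] eps_pos by simp
    have "ennreal (\<tau> 0 * (c * r\<^sup>2) ^ q) = (\<integral>\<^sup>+t. ennreal (\<tau> 0 * (c * r\<^sup>2) ^ q) \<partial>\<nu> 0)"
      by (simp add: emeasure_space_1)
    also have "\<dots> \<le> (\<integral>\<^sup>+t. ennreal (\<tau> 0 * m t) \<partial>\<nu> 0)"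
      by (rule nn_integral_mono_AE, use AE in eventually_elim) (intro ennreal_leI mult_left_mono m0 \<tau>)
    also have "\<dots> \<le> ennreal (K * M)"
      unfolding m_def c_def K_def by (rule averaged_bump_bound[OF P bdd]) simp
    finally have "\<tau> 0 * (c * r\<^sup>2) ^ q \<le> K * M"
      using K M by (subst (asm) ennreal_le_iff) auto
    thus ?thesis using c r by (simp add: pos_le_divide_eq)
  qed
  have ti: "\<tau> i * (\<integral>t. (norm (t - \<theta> i))\<^sup>2 \<partial>\<nu> i) \<le> K / e * M"
    if P: "(\<eta>, \<beta>, \<rho>, \<tau>, \<nu>) \<in> param_set q A" and bdd: "pairing_bounded \<epsilon> q \<theta> (\<eta>, \<beta>, \<rho>, \<tau>, \<nu>) M"
      and i: "i \<in> {1..q}"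
    for \<eta> \<beta> \<rho> \<tau> \<nu> M i
  proof -
    have \<nu>: "\<nu> i \<in> prob_on (A i)" and \<tau>: "0 \<le> \<tau> i" using P i by (auto simp: param_set_def)
    have AE: "AE t in \<nu> i. t \<in> A i" using \<nu> by (simp add: prob_on_def)
    have M: "0 \<le> M" using pairing_bounded_nonneg[OF bdd] eps_pos by simp
    have "ennreal (\<integral>t. \<tau> i * (e * (norm (t - \<theta> i))\<^sup>2) \<partial>\<nu> i) = (\<integral>\<^sup>+t. ennreal (\<tau> i * (e * (norm (t - \<theta> i))\<^sup>2)) \<partial>\<nu> i)"
      using integrable_norm_sq[OF \<nu> bounded_A[OF i], of "\<theta> i"] \<tau> e
      by (intro nn_integral_eq_integral[symmetric]) auto
    also have "\<dots> \<le> (\<integral>\<^sup>+t. ennreal (\<tau> i * m t) \<partial>\<nu> i)"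
      by (rule nn_integral_mono_AE, use AE in eventually_elim) (intro ennreal_leI mult_left_mono mi i \<tau>)
    also have "\<dots> \<le> ennreal (K * M)"
      unfolding m_def c_def K_def using i by (intro averaged_bump_bound[OF P bdd]) auto
    finally have "\<tau> i * (e * (\<integral>t. (norm (t - \<theta> i))\<^sup>2 \<partial>\<nu> i)) \<le> K * M"
      using K M by (subst (asm) ennreal_le_iff) auto
    thus ?thesis using e by (simp add: pos_le_divide_eq mult_ac)
  qed
  show ?thesis
    by (rule that[of "K / (c * r\<^sup>2) ^ q" "K / e"]) (blast intro: t0 ti)+
qed

lemma dispersion_bound:
  obtains C where "\<And>P M. P \<in> param_set q A \<Longrightarrow> pairing_bounded \<epsilon> q \<theta> P M \<Longrightarrow> dispersion q \<theta> P \<le> C * M"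
proof -
  obtain C0 C where C: "\<And>\<eta> \<beta> \<rho> \<tau> \<nu> M. (\<eta>, \<beta>, \<rho>, \<tau>, \<nu>) \<in> param_set q A \<Longrightarrow>
      pairing_bounded \<epsilon> q \<theta> (\<eta>, \<beta>, \<rho>, \<tau>, \<nu>) M \<Longrightarrow> \<tau> 0 \<le> C0 * M"
    "\<And>\<eta> \<beta> \<rho> \<tau> \<nu> M i. (\<eta>, \<beta>, \<rho>, \<tau>, \<nu>) \<in> param_set q A \<Longrightarrow>
      pairing_bounded \<epsilon> q \<theta> (\<eta>, \<beta>, \<rho>, \<tau>, \<nu>) M \<Longrightarrow> i \<in> {1..q} \<Longrightarrow>
      \<tau> i * (\<integral>t. (norm (t - \<theta> i))\<^sup>2 \<partial>\<nu> i) \<le> C * M"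
    using dispersion_bound_parts by metis
  have "\<exists>C. \<forall>\<eta> \<beta> \<rho> \<tau> \<nu> M. (\<eta>, \<beta>, \<rho>, \<tau>, \<nu>) \<in> param_set q A \<longrightarrow>
      pairing_bounded \<epsilon> q \<theta> (\<eta>, \<beta>, \<rho>, \<tau>, \<nu>) M \<longrightarrow> trace (\<rho> i) \<le> C * M" if "i \<in> {1..q}" for i
    using trace_bound[OF that] by metis
  then obtain D where D: "\<And>i \<eta> \<beta> \<rho> \<tau> \<nu> M. i \<in> {1..q} \<Longrightarrow> (\<eta>, \<beta>, \<rho>, \<tau>, \<nu>) \<in> param_set q A \<Longrightarrow>
      pairing_bounded \<epsilon> q \<theta> (\<eta>, \<beta>, \<rho>, \<tau>, \<nu>) M \<Longrightarrow> trace (\<rho> i) \<le> D i * M"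
    by metis
  have "dispersion q \<theta> P \<le> (C0 + (\<Sum>i=1..q. D i + C)) * M"
    if "P \<in> param_set q A" "pairing_bounded \<epsilon> q \<theta> P M" for P M
  proof -
    obtain \<eta> \<beta> \<rho> \<tau> \<nu> where P: "P = (\<eta>, \<beta>, \<rho>, \<tau>, \<nu>)" by (cases P)
    have "dispersion q \<theta> P \<le> C0 * M + (\<Sum>i=1..q. D i * M + C * M)"
      using C D that unfolding P dispersion.simps by (intro add_mono sum_mono) blast+
    also have "\<dots> = (C0 + (\<Sum>i=1..q. D i + C)) * M"
      by (simp add: ring_distribs sum_distrib_right sum.distrib)
    finally show ?thesis .
  qed
  thus ?thesis using that by blast
qed

text \<open>The bump without its factor i has double zeros at all other centres but a nonzero value
  at \<open>\<theta> i\<close>. Its gradient there need not vanish, so the vector coefficient must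
  be bounded first, using the extra sine; the scalar one then follows by subtraction.\<close>

lemma first_order_bounds:
  assumes i: "i \<in> {1..q}"
  obtains C where
    "\<And>\<eta> \<beta> \<rho> \<tau> \<nu> M. (\<eta>, \<beta>, \<rho>, \<tau>, \<nu>) \<in> param_set q A \<Longrightarrow>
      pairing_bounded \<epsilon> q \<theta> (\<eta>, \<beta>, \<rho>, \<tau>, \<nu>) M \<Longrightarrow>
      norm (\<beta> i + \<tau> i *\<^sub>R (\<integral>t. (t - \<theta> i) \<partial>\<nu> i)) \<le> C * (M + dispersion q \<theta> (\<eta>, \<beta>, \<rho>, \<tau>, \<nu>)) \<and>
      \<bar>\<eta> i + \<tau> i\<bar> \<le> C * (M + dispersion q \<theta> (\<eta>, \<beta>, \<rho>, \<tau>, \<nu>))"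
proof -
  obtain s where s: "\<And>k. norm (s k) \<le> \<delta>"
    and pos: "0 < (\<Prod>k\<in>{1..q} - {i}. 1 - cos (s k \<bullet> (\<theta> i - \<theta> k)))" (is "0 < ?\<kappa>")
    using separating_frequencies[OF i] by blast
  define Q where "Q = bump \<theta> s (filter (\<lambda>k. k \<noteq> i) [1..<Suc q])"
  have set: "set (filter (\<lambda>k. k \<noteq> i) [1..<Suc q]) = {1..q} - {i}" by auto
  have len: "length (filter (\<lambda>k. k \<noteq> i) [1..<Suc q]) \<le> q"
    using length_filter_le[of "\<lambda>k. k \<noteq> i" "[1..<Suc q]"] by (simp del: upt_Suc)
  have Q_val: "tval Q (\<theta> i) = of_real ?\<kappa>"
    unfolding Q_def using tval_bump[of "filter (\<lambda>k. k \<noteq> i) [1..<Suc q]" \<theta> s "\<theta> i", unfolded set]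
    by (simp del: upt_Suc)
  have Q_zero: "tval Q (\<theta> k) = 0" "tgrad Q (\<theta> k) v = 0" if "k \<in> {1..q}" "k \<noteq> i" for k v
    unfolding Q_def by (rule bump_vanishes, use that in \<open>simp add: set del: upt_Suc\<close>)+
  have Q_weight: "weight Q \<le> 2 ^ q"
    unfolding Q_def weight_bump using len by (intro power_increasing) auto
  have Q_freq: "freq_le (real q * \<delta>) Q"
    unfolding Q_def
    by (rule freq_le_mono[OF freq_le_bump[of _ s \<delta>]]) (use s len delta in \<open>auto intro!: mult_right_mono\<close>)
  \<comment> \<open>The constant of \<open>pairing_first_order\<close> at radius \<epsilon>; being
    at least 1, it also absorbs the term with \<open>M\<close>.\<close>
  define L where "L = 1 + (real CARD('d))\<^sup>2 * \<epsilon>\<^sup>2 + \<epsilon>\<^sup>2"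
  have L: "1 \<le> L" by (simp add: L_def)
  define C1 where "C1 = real CARD('d) * (2 ^ q * L / (?\<kappa> * \<delta>))"
  \<comment> \<open>Solves for the scalar coefficient: the second summand pays for the gradient of
    \<open>Q\<close> at \<open>\<theta> i\<close>, of size at most
    \<open>2 ^ q * \<epsilon>\<close>, acting on a vector already bounded through
    \<open>C1\<close>.\<close>
  define C2 where "C2 = (2 ^ q * L + 2 ^ q * \<epsilon> * C1) / ?\<kappa>"
  have C1: "0 \<le> C1" using L pos delta by (simp add: C1_def)
  have C2: "0 \<le> C2" using L pos eps_pos C1 by (simp add: C2_def)
  show ?thesis
  proof (rule that[of "C1 + C2"])
    fix \<eta> \<beta> \<rho> \<tau> \<nu> M
    assume P: "(\<eta>, \<beta>, \<rho>, \<tau>, \<nu>) \<in> param_set q A" and bdd: "pairing_bounded \<epsilon> q \<theta> (\<eta>, \<beta>, \<rho>, \<tau>, \<nu>) M"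
    define R where "R = dispersion q \<theta> (\<eta>, \<beta>, \<rho>, \<tau>, \<nu>)"
    have M: "0 \<le> M" using pairing_bounded_nonneg[OF bdd] eps_pos by simp
    have R: "0 \<le> R"
      using P unfolding R_def dispersion.simps param_set_def
      by (intro add_nonneg_nonneg sum_nonneg mult_nonneg_nonneg trace_psd_nonneg integral_nonneg_AE) auto
    define a where "a k = \<eta> k + \<tau> k" for k
    define b where "b k = \<beta> k + \<tau> k *\<^sub>R (\<integral>t. (t - \<theta> k) \<partial>\<nu> k)" for k
    \<comment> \<open>For a test function with double zeros at all other centres, the first-order
      expansion collapses to its term at \<open>\<theta> i\<close>.\<close>
    have key: "norm (of_real (a i) * tval p (\<theta> i) + tgrad p (\<theta> i) (b i)) \<le> 2 ^ q * L * (M + R)"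
      if p: "freq_le \<epsilon> p" "weight p \<le> 2 ^ q"
        and zero: "\<And>k. k \<in> {1..q} \<Longrightarrow> k \<noteq> i \<Longrightarrow> tval p (\<theta> k) = 0"
          "\<And>k v. k \<in> {1..q} \<Longrightarrow> k \<noteq> i \<Longrightarrow> tgrad p (\<theta> k) v = 0" for p
    proof -
      define T where "T = pairing q \<theta> (\<eta>, \<beta>, \<rho>, \<tau>, \<nu>) p"
      have "(\<Sum>k=1..q. of_real (a k) * tval p (\<theta> k) + tgrad p (\<theta> k) (b k))
          = of_real (a i) * tval p (\<theta> i) + tgrad p (\<theta> i) (b i)"
        using i zero by (subst sum.remove[of _ i]) auto
      moreover have "norm (T - (\<Sum>k=1..q. of_real (a k) * tval p (\<theta> k) + tgrad p (\<theta> k) (b k))) \<le> weight p * L * R"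
        unfolding T_def L_def R_def a_def b_def by (rule pairing_first_order[OF P bounded_A p(1)])
      ultimately have "norm (T - (of_real (a i) * tval p (\<theta> i) + tgrad p (\<theta> i) (b i))) \<le> weight p * L * R"
        by simp
      moreover have "norm T \<le> weight p * M"
        using bdd p(1) by (auto simp: pairing_bounded_def T_def)
      ultimately have "norm (of_real (a i) * tval p (\<theta> i) + tgrad p (\<theta> i) (b i)) \<le> weight p * M + weight p * L * R"
        by (smt (verit) norm_triangle_sub norm_minus_commute)
      also have "\<dots> \<le> 2 ^ q * (L * M) + 2 ^ q * (L * R)"
      proof (intro add_mono)
        show "weight p * M \<le> 2 ^ q * (L * M)"
          using L M p(2) by (intro mult_mono) (auto simp: mult_le_cancel_right1)
        show "weight p * L * R \<le> 2 ^ q * (L * R)"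
          using L R p(2) by (simp add: mult_right_mono mult.assoc)
      qed
      finally show ?thesis by (simp add: algebra_simps)
    qed
    have "\<bar>b i $ j\<bar> \<le> 2 ^ q * L / (?\<kappa> * \<delta>) * (M + R)" for j
    proof -
      define p where "p = tmult (sine (\<delta> *\<^sub>R axis j 1) (\<theta> i)) Q"
      have "freq_le (\<delta> + real q * \<delta>) p"
        unfolding p_def using delta by (intro freq_le_mult sine_simps Q_freq) simp
      hence "freq_le \<epsilon> p" by (rule freq_le_mono) (use delta(4) in simp)
      moreover have "weight p \<le> 2 ^ q" using Q_weight by (simp add: p_def trig_mult sine_simps)
      ultimately have "norm (of_real (a i) * tval p (\<theta> i) + tgrad p (\<theta> i) (b i)) \<le> 2 ^ q * L * (M + R)"
        by (rule key) (simp_all add: p_def trig_mult Q_zero)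
      moreover have "of_real (a i) * tval p (\<theta> i) + tgrad p (\<theta> i) (b i) = of_real (\<delta> * b i $ j * ?\<kappa>)"
        by (simp add: p_def trig_mult sine_simps Q_val inner_axis' del: of_real_prod)
      ultimately have "\<bar>\<delta> * b i $ j * ?\<kappa>\<bar> \<le> 2 ^ q * L * (M + R)"
        by (metis norm_of_real)
      thus ?thesis using pos delta(1)
        by (simp add: pos_le_divide_eq abs_mult mult_ac del: abs_prod)
    qed
    hence "(\<Sum>j\<in>UNIV. \<bar>b i $ j\<bar>) \<le> (\<Sum>j\<in>(UNIV::'d set). 2 ^ q * L / (?\<kappa> * \<delta>) * (M + R))"
      by (intro sum_mono)
    hence b: "norm (b i) \<le> C1 * (M + R)"
      using norm_le_l1_cart[of "b i"] by (simp add: C1_def)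
    have "freq_le \<epsilon> Q" using Q_freq delta(3) by (rule freq_le_mono)
    hence "norm (of_real (a i) * tval Q (\<theta> i) + tgrad Q (\<theta> i) (b i)) \<le> 2 ^ q * L * (M + R)"
      by (rule key) (use Q_weight Q_zero in auto)
    moreover have "norm (tgrad Q (\<theta> i) (b i)) \<le> 2 ^ q * \<epsilon> * (C1 * (M + R))"
      by (rule order_trans[OF tgrad_bound[OF \<open>freq_le \<epsilon> Q\<close>]])
         (use Q_weight b eps_pos in \<open>intro mult_mono; auto\<close>)
    ultimately have "norm (of_real (a i) * tval Q (\<theta> i)) \<le> 2 ^ q * L * (M + R) + 2 ^ q * \<epsilon> * (C1 * (M + R))"
      by (smt (verit) norm_diff_ineq)
    moreover have "norm (of_real (a i) * tval Q (\<theta> i)) = \<bar>a i\<bar> * ?\<kappa>"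
      using pos by (simp add: Q_val norm_mult del: of_real_prod abs_prod)
    ultimately have a: "\<bar>a i\<bar> \<le> C2 * (M + R)"
      using pos by (simp add: C2_def pos_le_divide_eq algebra_simps)
    have "norm (b i) \<le> (C1 + C2) * (M + R)"
      using b C2 M R by (simp add: distrib_right add_increasing2)
    moreover have "\<bar>a i\<bar> \<le> (C1 + C2) * (M + R)"
      using a C1 M R by (simp add: distrib_right add_increasing)
    ultimately show "norm (\<beta> i + \<tau> i *\<^sub>R (\<integral>t. (t - \<theta> i) \<partial>\<nu> i)) \<le> (C1 + C2) * (M + dispersion q \<theta> (\<eta>, \<beta>, \<rho>, \<tau>, \<nu>)) \<and>
      \<bar>\<eta> i + \<tau> i\<bar> \<le> (C1 + C2) * (M + dispersion q \<theta> (\<eta>, \<beta>, \<rho>, \<tau>, \<nu>))"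
      by (simp add: a_def b_def R_def)
  qed
qed

lemma N_size_bound:
  obtains K where "\<And>P M. P \<in> param_set q A \<Longrightarrow> pairing_bounded \<epsilon> q \<theta> P M \<Longrightarrow> N_size q \<theta> P \<le> K * M"
proof -
  obtain C where C: "\<And>P M. P \<in> param_set q A \<Longrightarrow> pairing_bounded \<epsilon> q \<theta> P M \<Longrightarrow> dispersion q \<theta> P \<le> C * M"
    using dispersion_bound by blast
  have "\<exists>E. \<forall>\<eta> \<beta> \<rho> \<tau> \<nu> M. (\<eta>, \<beta>, \<rho>, \<tau>, \<nu>) \<in> param_set q A \<longrightarrow>
      pairing_bounded \<epsilon> q \<theta> (\<eta>, \<beta>, \<rho>, \<tau>, \<nu>) M \<longrightarrow>
      norm (\<beta> i + \<tau> i *\<^sub>R (\<integral>t. (t - \<theta> i) \<partial>\<nu> i)) \<le> E * (M + dispersion q \<theta> (\<eta>, \<beta>, \<rho>, \<tau>, \<nu>)) \<and>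
      \<bar>\<eta> i + \<tau> i\<bar> \<le> E * (M + dispersion q \<theta> (\<eta>, \<beta>, \<rho>, \<tau>, \<nu>))" if "i \<in> {1..q}" for i
    by (rule first_order_bounds[OF that]) blast
  then obtain E where E: "\<And>i \<eta> \<beta> \<rho> \<tau> \<nu> M. i \<in> {1..q} \<Longrightarrow> (\<eta>, \<beta>, \<rho>, \<tau>, \<nu>) \<in> param_set q A \<Longrightarrow>
      pairing_bounded \<epsilon> q \<theta> (\<eta>, \<beta>, \<rho>, \<tau>, \<nu>) M \<Longrightarrow>
      norm (\<beta> i + \<tau> i *\<^sub>R (\<integral>t. (t - \<theta> i) \<partial>\<nu> i)) \<le> E i * (M + dispersion q \<theta> (\<eta>, \<beta>, \<rho>, \<tau>, \<nu>)) \<and>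
      \<bar>\<eta> i + \<tau> i\<bar> \<le> E i * (M + dispersion q \<theta> (\<eta>, \<beta>, \<rho>, \<tau>, \<nu>))"
    by metis
  \<comment> \<open>The constants \<open>E i\<close> are obtained without a sign, hence the absolute
    values before summing.\<close>
  define F where "F = (\<Sum>i=1..q. \<bar>E i\<bar>)"
  have F: "0 \<le> F" by (simp add: F_def sum_nonneg)
  have "N_size q \<theta> P \<le> (C + 2 * F * (1 + C)) * M"
    if PA: "P \<in> param_set q A" and bdd: "pairing_bounded \<epsilon> q \<theta> P M" for P M
  proof -
    obtain \<eta> \<beta> \<rho> \<tau> \<nu> where P: "P = (\<eta>, \<beta>, \<rho>, \<tau>, \<nu>)" by (cases P)
    note PA' = PA[unfolded P] and bdd' = bdd[unfolded P]
    have M: "0 \<le> M" using pairing_bounded_nonneg[OF bdd] eps_pos by simp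
    define R where "R = dispersion q \<theta> P"
    have \<tau>: "0 \<le> \<tau> i" if "i \<in> {0..q}" for i using PA' that by (auto simp: param_set_def)
    have R: "0 \<le> R"
      using PA' unfolding R_def P dispersion.simps param_set_def
      by (intro add_nonneg_nonneg sum_nonneg mult_nonneg_nonneg trace_psd_nonneg integral_nonneg_AE) auto
    have E': "norm (\<beta> i + \<tau> i *\<^sub>R (\<integral>t. (t - \<theta> i) \<partial>\<nu> i)) \<le> \<bar>E i\<bar> * (M + R)"
      "\<bar>\<eta> i + \<tau> i\<bar> \<le> \<bar>E i\<bar> * (M + R)" if "i \<in> {1..q}" for i
    proof -
      have "E i * (M + R) \<le> \<bar>E i\<bar> * (M + R)" using M R by (intro mult_right_mono) auto
      with E[OF that PA' bdd'] show
        "norm (\<beta> i + \<tau> i *\<^sub>R (\<integral>t. (t - \<theta> i) \<partial>\<nu> i)) \<le> \<bar>E i\<bar> * (M + R)"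
        "\<bar>\<eta> i + \<tau> i\<bar> \<le> \<bar>E i\<bar> * (M + R)"
        unfolding P[symmetric] R_def[symmetric] by linarith+
    qed
    have "(\<Sum>i=1..q. \<bar>\<eta> i + \<tau> i\<bar>) \<le> (\<Sum>i=1..q. \<bar>E i\<bar> * (M + R))"
      by (intro sum_mono E')
    hence 1: "(\<Sum>i=1..q. \<bar>\<eta> i + \<tau> i\<bar>) \<le> F * (M + R)" by (simp add: F_def sum_distrib_right)
    have "(\<Sum>i=1..q. norm (\<beta> i + \<tau> i *\<^sub>R (\<integral>t. (t - \<theta> i) \<partial>\<nu> i))) \<le> (\<Sum>i=1..q. \<bar>E i\<bar> * (M + R))"
      by (intro sum_mono E')
    hence 2: "(\<Sum>i=1..q. norm (\<beta> i + \<tau> i *\<^sub>R (\<integral>t. (t - \<theta> i) \<partial>\<nu> i))) \<le> F * (M + R)"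
      by (simp add: F_def sum_distrib_right)
    have "(\<Sum>i=1..q. \<tau> i / 2 * (\<integral>t. (norm (t - \<theta> i))\<^sup>2 \<partial>\<nu> i))
        \<le> (\<Sum>i=1..q. \<tau> i * (\<integral>t. (norm (t - \<theta> i))\<^sup>2 \<partial>\<nu> i))"
      using \<tau> by (intro sum_mono mult_right_mono integral_nonneg_AE) auto
    hence 3: "\<tau> 0 + (\<Sum>i=1..q. trace (\<rho> i)) + (\<Sum>i=1..q. \<tau> i / 2 * (\<integral>t. (norm (t - \<theta> i))\<^sup>2 \<partial>\<nu> i)) \<le> R"
      by (simp add: R_def P sum.distrib)
    have "N_size q \<theta> P \<le> R + 2 * (F * (M + R))"
      using 1 2 3 by (simp add: P)
    also have "\<dots> \<le> C * M + 2 * (F * (M + C * M))"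
      using C[OF PA bdd] F unfolding R_def[symmetric] by (intro add_mono mult_left_mono) auto
    also have "\<dots> = (C + 2 * F * (1 + C)) * M" by (simp add: algebra_simps)
    finally show ?thesis .
  qed
  thus ?thesis using that by blast
qed

end

section \<open>From the pairing back to the norm of \<open>ell\<close>\<close>

lemma pairing_le_integral:
  fixes f0 :: "real^'d \<Rightarrow> real"
  assumes C2: "Ck 2 f0"
    and f0: "integrable lborel f0" "integral\<^sup>L lborel f0 = 1"
    and I1: "\<And>i. integrable lborel (partial_deriv i f0)"
    and I2: "\<And>i j. integrable lborel (partial_deriv i (partial_deriv j f0))"
  obtains \<epsilon> where "0 < \<epsilon>" "\<And>q \<theta> P A. P \<in> param_set q A \<Longrightarrow>
    pairing_bounded \<epsilon> q \<theta> P (2 * (\<integral>x. \<bar>mixture_density f0 q \<theta> P x\<bar> \<partial>lborel))"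
proof -
  obtain \<epsilon> where \<epsilon>: "0 < \<epsilon>" "\<And>s. norm s \<le> \<epsilon> \<Longrightarrow> 1 / 2 \<le> norm (ft f0 s)"
    using ft_near_zero[OF f0] by blast
  \<comment> \<open>The minimum with 1/2 ensures \<open>norm s < 1\<close>, as
    \<open>ft_mixture_density\<close> requires.\<close>
  define \<epsilon>' where "\<epsilon>' = min \<epsilon> (1 / 2)"
  have "norm (pairing q \<theta> P p) \<le> weight p * (2 * (\<integral>x. \<bar>mixture_density f0 q \<theta> P x\<bar> \<partial>lborel))"
    if P: "P \<in> param_set q A" and p: "freq_le \<epsilon>' p" for q \<theta> A and P :: "'d params" and p
    using p
  proof (induction p)
    case (Cons cs p)
    obtain c s where cs: "cs = (c, s)" by force
    define I where "I = (\<integral>x. \<bar>mixture_density f0 q \<theta> P x\<bar> \<partial>lborel)"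
    have s: "norm s \<le> \<epsilon>" "norm s < 1" using Cons.prems by (auto simp: cs \<epsilon>'_def)
    \<comment> \<open>The transform of \<open>L\<close> factors as \<open>ft f0 s\<close> times the
      pairing, and its modulus is at most the integral of \<open>\<bar>L\<bar>\<close>; dividing by
      the lower bound 1/2 produces the factor 2.\<close>
    have "norm (ft f0 s) * norm (pairing q \<theta> P [(1, s)]) \<le> I"
      using norm_ft_le[of "mixture_density f0 q \<theta> P" s]
      by (simp add: ft_mixture_density[OF C2 f0(1) I1 I2 P s(2)] norm_mult I_def)
    moreover have "1 / 2 * norm (pairing q \<theta> P [(1, s)]) \<le> norm (ft f0 s) * norm (pairing q \<theta> P [(1, s)])"
      using \<epsilon>(2)[OF s(1)] by (intro mult_right_mono) auto
    ultimately have "norm c * norm (pairing q \<theta> P [(1, s)]) \<le> norm c * (2 * I)"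
      by (intro mult_left_mono) auto
    hence "norm (c * pairing q \<theta> P [(1, s)] + pairing q \<theta> P p) \<le> norm c * (2 * I) + weight p * (2 * I)"
      using Cons by (intro norm_triangle_mono) (auto simp: norm_mult cs I_def)
    thus ?case by (simp add: cs pairing_Cons[OF P, of _ c s] I_def ring_distribs)
  qed simp
  moreover have "0 < \<epsilon>'" using \<epsilon> by (simp add: \<epsilon>'_def)
  ultimately show ?thesis using that unfolding pairing_bounded_def by blast
qed

theorem theorem3p10:
  fixes f0 fs :: "real^'d \<Rightarrow> real"
    and q :: nat and p :: "nat \<Rightarrow> real" and \<theta> :: "nat \<Rightarrow> real^'d"
    and A :: "nat \<Rightarrow> (real^'d) set" and u :: "'d \<Rightarrow> real^'d"
  assumes f0_meas: "f0 \<in> borel_measurable lborel"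
    and f0_pos: "\<And>x. 0 < f0 x"
    and f0_density: "(\<integral>\<^sup>+ x. ennreal (f0 x) \<partial>lborel) = 1"
    and p_pos: "\<And>i. i \<in> {1..q} \<Longrightarrow> 0 < p i"
    and p_sum: "(\<Sum>i=1..q. p i) = 1"
    and \<theta>_distinct: "inj_on \<theta> {1..q}"
    and fs: "fs = finite_mixture f0 q p \<theta>"
    and A_bounded: "\<And>i. i \<in> {1..q} \<Longrightarrow> bounded (A i)"
    and A_convex: "\<And>i. i \<in> {1..q} \<Longrightarrow> convex (A i)"
    and A_nhd: "\<And>i. i \<in> {1..q} \<Longrightarrow> \<theta> i \<in> interior (A i)"
    and u_indep: "inj u" "independent (range u)"
    and A_proj_disjoint: "\<And>j. disjoint_family_on (\<lambda>i. (\<lambda>t. t \<bullet> u j) ` A i) {1..q}"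
    and A_0: "A 0 = - (\<Union>i\<in>{1..q}. A i)"
    and f0_C2: "Ck 2 f0"
    and f0_vanish: "(f0 \<longlongrightarrow> 0) at_infinity"
    and D1_vanish: "(D1 f0 0 \<longlongrightarrow> 0) at_infinity"
    and D1_L1: "\<And>i. L1_norm fs (\<lambda>x. D1 f0 0 x $ i / fs x) < \<infinity>"
    and D2_L1: "\<And>i j. L1_norm fs (\<lambda>x. D2 f0 0 x $ i $ j / fs x) < \<infinity>"
  shows "\<exists>c>0. \<forall>P \<in> param_set q A. ennreal (c * N_size q \<theta> P) \<le> L1_norm fs (ell f0 fs q \<theta> P)"
proof -
  have fs_pos: "0 < fs x" for x
  proof -
    have "{1..q} \<noteq> {}" using p_sum by (metis sum.empty zero_neq_one)
    thus ?thesis unfolding fs finite_mixture_def translate_def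
      by (intro sum_pos mult_pos_pos p_pos f0_pos) auto
  qed
  \<comment> \<open>The weight \<open>fs\<close> cancels, so the norm hypotheses amount to Lebesgue
    integrability of the derivatives of \<open>f0\<close>. Only absolute values of h and g are
    compared because \<open>D1\<close> carries a minus sign.\<close>
  have integrable_of_L1_norm: "integrable lborel g"
    if "continuous_on UNIV g" "\<And>x. \<bar>h x\<bar> = \<bar>g x\<bar>" "L1_norm fs (\<lambda>x. h x / fs x) < \<infinity>"
    for g h :: "real^'d \<Rightarrow> real"
  proof (rule integrableI_bounded)
    show "g \<in> borel_measurable lborel"
      using borel_measurable_continuous_onI[OF that(1)] by simp
    have "\<bar>h x / fs x\<bar> * fs x = norm (g x)" for x
      using fs_pos[of x] that(2)[of x] by (simp add: abs_divide)
    thus "(\<integral>\<^sup>+x. ennreal (norm (g x)) \<partial>lborel) < \<infinity>"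
      using that(3) by (simp add: L1_norm_def)
  qed
  have I1: "integrable lborel (partial_deriv i f0)" for i
    by (rule integrable_of_L1_norm[OF Ck2_continuous_derivs(1)[OF f0_C2] _ D1_L1[of i]])
       (simp add: D1_eq[OF f0_C2])
  have I2: "integrable lborel (partial_deriv i (partial_deriv j f0))" for i j
    by (rule integrable_of_L1_norm[OF Ck2_continuous_derivs(2)[OF f0_C2] _ D2_L1[of i j]])
       (simp add: D2_eq[OF f0_C2])
  have f0: "integrable lborel f0"
    using f0_density f0_pos f0_meas by (intro integrableI_nonneg) (auto intro!: AE_I2 less_imp_le)
  have "integral\<^sup>L lborel f0 = 1"
    using f0_density f0_pos f0_meas by (subst integral_eq_nn_integral) (auto intro!: AE_I2 less_imp_le)
  from pairing_le_integral[OF f0_C2 f0 this I1 I2] obtain \<epsilon> where \<epsilon>: "0 < \<epsilon>"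
    and bdd: "\<And>q \<theta> P A. P \<in> param_set q A \<Longrightarrow>
      pairing_bounded \<epsilon> q \<theta> P (2 * (\<integral>x. \<bar>mixture_density f0 q \<theta> P x\<bar> \<partial>lborel))"
    by blast
  \<comment> \<open>A common point of \<open>A i\<close> and \<open>A k\<close> would give a common
    projection onto any \<open>u j\<close>; types are inhabited, so \<open>undefined\<close> names
    an index.\<close>
  have "disjoint_family_on A {1..q}"
    using A_proj_disjoint[of undefined] unfolding disjoint_family_on_def by fast
  then interpret separated_neighbourhoods q \<theta> A \<epsilon>
    by unfold_locales (use A_bounded A_nhd A_0 \<epsilon> in auto)
  obtain K where K: "\<And>P M. P \<in> param_set q A \<Longrightarrow> pairing_bounded \<epsilon> q \<theta> P M \<Longrightarrow> N_size q \<theta> P \<le> K * M"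
    using N_size_bound by blast
  \<comment> \<open>The 2 undoes the factor from \<open>pairing_le_integral\<close>; the maximum
    with 1 makes c positive whatever the sign of \<open>K\<close>.\<close>
  define c where "c = 1 / (2 * max 1 K)"
  have "ennreal (c * N_size q \<theta> P) \<le> L1_norm fs (ell f0 fs q \<theta> P)" if P: "P \<in> param_set q A" for P
  proof -
    define I where "I = (\<integral>x. \<bar>mixture_density f0 q \<theta> P x\<bar> \<partial>lborel)"
    have I: "0 \<le> I" by (simp add: I_def)
    have "\<bar>ell f0 fs q \<theta> P x\<bar> * fs x = \<bar>mixture_density f0 q \<theta> P x\<bar>" for x
      using ell_times_density[of fs x f0 q \<theta> P] fs_pos[of x]
      by (metis abs_mult abs_of_pos less_irrefl)
    hence "L1_norm fs (ell f0 fs q \<theta> P) = ennreal I"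
      using integrable_mixture_density[OF f0_C2 f0 I1 I2 P]
      by (simp add: L1_norm_def I_def nn_integral_eq_integral)
    moreover have "c * N_size q \<theta> P \<le> I"
    proof -
      have "N_size q \<theta> P \<le> K * (2 * I)" using K[OF P bdd[OF P]] by (simp add: I_def)
      also have "\<dots> \<le> max 1 K * (2 * I)" using I by (intro mult_right_mono) auto
      finally show ?thesis by (simp add: c_def pos_divide_le_eq mult_ac)
    qed
    ultimately show ?thesis by (simp add: ennreal_leI)
  qed
  moreover have "0 < c" by (simp add: c_def)
  ultimately show ?thesis by blast
qed

end
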